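(* Let $(M, J)$ be a complex surface (real dimension $4$, not necessarily compact) with complex structure $J$, and let $g$ be a gradient shrinking Ricci soliton on $M$, i.e. $g$ is a complete Riemannian metric on $M$ satisfying $$\mathrm{Ric} + \nabla^2 f = \tfrac{1}{2} g$$ for some smooth function $f : M \to \mathbb{R}$. Suppose that $g$ is Hermitian, i.e. $g(JX, JY) = g(X, Y)$ for all tangent vectors $X, Y$ at the same point of $M$, and that the Ricci tensor $\mathrm{Ric}$ of $g$ is $J$-invariant, i.e. $\mathrm{Ric}(JX, JY) = \mathrm{Ric}(X, Y)$ for all such $X, Y$. Let $\omega$ be the Hermitian form $\omega(X, Y) := g(X, JY)$, and let $\mathrm{Ric}_0 := \mathrm{Ric} - \frac{R}{4} g$ be the trace-free part of the Ricci tensor, where $R$ is the scalar curvature of $g$. Then the following identity of differential forms holds on $M$: $$\mathrm{Ric}_0(\nabla f, \cdot) \wedge d\omega = 0.$$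
   Context: $\nabla f$ denotes the gradient of $f$ with respect to $g$, and $\nabla^2 f$ its Hessian with respect to the Levi-Civita connection of $g$. $\mathrm{Ric}_0(\nabla f, \cdot)$ is the $1$-form $X \mapsto \mathrm{Ric}_0(\nabla f, X)$. $d$ is the exterior derivative, and $J$ is an integrable complex structure on $M$, regarded as an endomorphism of $TM$ with $J^2 = -I$. *)

theory Defs
  imports "HOL-Analysis.Analysis"
begin

section \<open>Smooth functions on open subsets of a Euclidean space\<close>

primrec Ck_on :: "nat \<Rightarrow> 'e::euclidean_space set \<Rightarrow> ('e \<Rightarrow> 'b::real_normed_vector) \<Rightarrow> bool" where
  "Ck_on 0 S F \<longleftrightarrow> continuous_on S F"
| "Ck_on (Suc k) S F \<longleftrightarrow> (\<forall>x\<in>S. F differentiable (at x)) \<and>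
     (\<forall>v. Ck_on k S (\<lambda>x. frechet_derivative F (at x) v))"

definition smooth_on :: "'e::euclidean_space set \<Rightarrow> ('e \<Rightarrow> 'b::real_normed_vector) \<Rightarrow> bool" where
  "smooth_on S F \<longleftrightarrow> (\<forall>k. Ck_on k S F)"

definition dir_deriv :: "('e::euclidean_space \<Rightarrow> 'b::real_normed_vector) \<Rightarrow> 'e \<Rightarrow> 'e \<Rightarrow> 'b" where
  "dir_deriv F x v = frechet_derivative F (at x) v"


section \<open>Riemannian geometry in one coordinate chart\<close>

text \<open>
  A covariant 2-tensor field on an open subset of the coordinate space \<open>'e\<close> is a function
  \<open>h\<close>, where \<open>h x u v\<close> is its value at the point \<open>x\<close> on the tangent vectors \<open>u\<close>, \<open>v\<close>.
  In the formulas below the vectors \<open>u\<close>, \<open>v\<close>, \<open>w\<close> are also regarded as the coordinate vector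
  fields with these constant components; such fields commute, so the bracket terms of the
  invariant formulas vanish.
\<close>

type_synonym 'e tensor2 = "'e \<Rightarrow> 'e \<Rightarrow> 'e \<Rightarrow> real"

definition endo_trace :: "('e::euclidean_space \<Rightarrow> 'e) \<Rightarrow> real" where
  "endo_trace T = (\<Sum>b\<in>Basis. T b \<bullet> b)"

definition inner_product_form :: "('e::euclidean_space \<Rightarrow> 'e \<Rightarrow> real) \<Rightarrow> bool" where
  "inner_product_form q \<longleftrightarrow>
     bilinear q \<and> (\<forall>u v. q u v = q v u) \<and> (\<forall>u. u \<noteq> 0 \<longrightarrow> q u u > 0)"

definition sharp :: "'e::euclidean_space tensor2 \<Rightarrow> 'e \<Rightarrow> ('e \<Rightarrow> real) \<Rightarrow> 'e" where
  "sharp h x \<alpha> = (THE z. \<forall>w. h x z w = \<alpha> w)"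

lemma sharp_works:
  assumes q: "inner_product_form (h x)" and \<alpha>: "linear \<alpha>"
  shows "h x (sharp h x \<alpha>) w = \<alpha> w"
proof -
  from q have bil: "bilinear (h x)" and pos: "\<And>u. u \<noteq> 0 \<Longrightarrow> h x u u > 0"
    by (auto simp: inner_product_form_def)
  define L where "L z = (\<Sum>b\<in>Basis. h x z b *\<^sub>R b)" for z
  have L_inner: "L z \<bullet> b = h x z b" if "b \<in> Basis" for z b
    using that by (simp add: L_def)
  have linL: "linear L"
    unfolding L_def using bil
    by (intro linearI)
      (simp_all add: bilinear_ladd bilinear_lmul scaleR_left_distrib sum.distrib
        scaleR_sum_right)
  have ext: "\<beta> = \<gamma>" if "linear \<beta>" "linear \<gamma>" "\<And>b. b \<in> Basis \<Longrightarrow> \<beta> b = \<gamma> b"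
    for \<beta> \<gamma> :: "'a \<Rightarrow> real"
    using linear_eq_stdbasis[of \<beta> \<gamma>] that by auto
  have lin_r: "linear (h x z)" for z
    using bil by (simp add: bilinear_def)
  have "inj L"
  proof (subst linear_injective_0[OF linL], intro allI impI)
    fix z assume "L z = 0"
    then have "h x z = (\<lambda>_. 0)"
      by (intro ext lin_r) (simp_all add: linear_zero flip: L_inner)
    then show "z = 0" using pos[of z] by fastforce
  qed
  then have "surj L" using linear_injective_imp_surjective[OF linL] by simp
  then obtain z where z: "(\<Sum>b\<in>Basis. \<alpha> b *\<^sub>R b) = L z" by (auto dest: surjD)
  have "\<alpha> b = h x z b" if "b \<in> Basis" for b
    using L_inner[OF that, of z] that by (simp flip: z)
  then have zz: "h x z = \<alpha>" by (intro ext lin_r \<alpha>) auto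
  have "y = z" if "\<forall>w. h x y w = \<alpha> w" for y
  proof -
    have "h x (y - z) (y - z) = 0"
      using that zz by (simp add: bilinear_lsub[OF bil])
    then show ?thesis using pos[of "y - z"] by fastforce
  qed
  then have "sharp h x \<alpha> = z"
    unfolding sharp_def using zz by (intro the_equality) auto
  then show ?thesis using zz by simp
qed

definition gradient :: "'e::euclidean_space tensor2 \<Rightarrow> ('e \<Rightarrow> real) \<Rightarrow> 'e \<Rightarrow> 'e" where
  "gradient h F x = sharp h x (dir_deriv F x)"

text \<open>
  \<open>christoffel h x u v\<close> is \<open>\<nabla>\<^sub>u v\<close> for the Levi-Civita connection of \<open>h\<close> (Koszul formula).
\<close>

definition christoffel :: "'e::euclidean_space tensor2 \<Rightarrow> 'e \<Rightarrow> 'e \<Rightarrow> 'e \<Rightarrow> 'e" where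
  "christoffel h x u v = sharp h x (\<lambda>w.
     (dir_deriv (\<lambda>y. h y v w) x u + dir_deriv (\<lambda>y. h y u w) x v
      - dir_deriv (\<lambda>y. h y u v) x w) / 2)"

text \<open>\<open>riemann h x u v w\<close> is \<open>\<nabla>\<^sub>u \<nabla>\<^sub>v w - \<nabla>\<^sub>v \<nabla>\<^sub>u w\<close>.\<close>

definition riemann :: "'e::euclidean_space tensor2 \<Rightarrow> 'e \<Rightarrow> 'e \<Rightarrow> 'e \<Rightarrow> 'e \<Rightarrow> 'e" where
  "riemann h x u v w =
     dir_deriv (\<lambda>y. christoffel h y v w) x u + christoffel h x u (christoffel h x v w)
     - dir_deriv (\<lambda>y. christoffel h y u w) x v - christoffel h x v (christoffel h x u w)"

definition ricci :: "'e::euclidean_space tensor2 \<Rightarrow> 'e tensor2" where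
  "ricci h x v w = endo_trace (\<lambda>u. riemann h x u v w)"

definition scalar_curvature :: "'e::euclidean_space tensor2 \<Rightarrow> 'e \<Rightarrow> real" where
  "scalar_curvature h x = endo_trace (\<lambda>u. sharp h x (ricci h x u))"

definition hessian :: "'e::euclidean_space tensor2 \<Rightarrow> ('e \<Rightarrow> real) \<Rightarrow> 'e tensor2" where
  "hessian h F x u v =
     dir_deriv (\<lambda>y. dir_deriv F y v) x u - dir_deriv F x (christoffel h x u v)"

definition tracefree_ricci :: "(complex^2) tensor2 \<Rightarrow> (complex^2) tensor2" where
  "tracefree_ricci h x u v = ricci h x u v - scalar_curvature h x / 4 * h x u v"

definition ext_deriv_2form :: "'e::euclidean_space tensor2 \<Rightarrow> 'e \<Rightarrow> 'e \<Rightarrow> 'e \<Rightarrow> 'e \<Rightarrow> real" where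
  "ext_deriv_2form \<eta> x u v w =
     dir_deriv (\<lambda>y. \<eta> y v w) x u - dir_deriv (\<lambda>y. \<eta> y u w) x v + dir_deriv (\<lambda>y. \<eta> y u v) x w"

definition wedge_1_3 :: "('e \<Rightarrow> real) \<Rightarrow> ('e \<Rightarrow> 'e \<Rightarrow> 'e \<Rightarrow> real) \<Rightarrow> 'e \<Rightarrow> 'e \<Rightarrow> 'e \<Rightarrow> 'e \<Rightarrow> real" where
  "wedge_1_3 \<alpha> \<beta> u1 u2 u3 u4 =
     \<alpha> u1 * \<beta> u2 u3 u4 - \<alpha> u2 * \<beta> u1 u3 u4 + \<alpha> u3 * \<beta> u1 u2 u4 - \<alpha> u4 * \<beta> u1 u2 u3"


section \<open>Complex surfaces\<close>

text \<open>
  A chart is a pair of its domain and its coordinate map. A tangent vector at a point of the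
  domain is given by its components, a vector in \<open>complex^2\<close> (a real Euclidean space of
  dimension 4).
\<close>

type_synonym 'a chart = "'a set \<times> ('a \<Rightarrow> complex^2)"

abbreviation chart_dom :: "'a chart \<Rightarrow> 'a set" where
  "chart_dom c \<equiv> fst c"

abbreviation coord :: "'a chart \<Rightarrow> 'a \<Rightarrow> complex^2" where
  "coord c \<equiv> snd c"

definition chart_img :: "'a chart \<Rightarrow> (complex^2) set" where
  "chart_img c = coord c ` chart_dom c"

definition chart_point :: "'a chart \<Rightarrow> complex^2 \<Rightarrow> 'a" where
  "chart_point c = inv_into (chart_dom c) (coord c)"

definition transition :: "'a chart \<Rightarrow> 'a chart \<Rightarrow> complex^2 \<Rightarrow> complex^2" where
  "transition c d = coord d \<circ> chart_point c"

definition is_chart :: "'a topology \<Rightarrow> 'a chart \<Rightarrow> bool" where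
  "is_chart M c \<longleftrightarrow> openin M (chart_dom c) \<and> open (chart_img c) \<and>
     homeomorphic_map (subtopology M (chart_dom c)) (top_of_set (chart_img c)) (coord c)"

text \<open>
  In every holomorphic chart the complex structure is multiplication of the components by
  \<open>\<i>\<close>. By complex linearity of the differentials of the transition maps this is a
  well-defined endomorphism of the tangent bundle; see \<open>J_transition\<close> below.
\<close>

definition J :: "complex^2 \<Rightarrow> complex^2" where
  "J v = \<i> *s v"

lemma J_J: "J (J v) = - v"
  by (simp add: J_def vec_eq_iff flip: mult.assoc)

definition holomorphic_map_on :: "(complex^2) set \<Rightarrow> (complex^2 \<Rightarrow> complex^2) \<Rightarrow> bool" where
  "holomorphic_map_on S F \<longleftrightarrow>
     (\<forall>x\<in>S. \<exists>D. (F has_derivative D) (at x) \<and> (\<forall>a v. D (a *s v) = a *s D v))"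

definition complex_surface :: "'a topology \<Rightarrow> 'a chart set \<Rightarrow> bool" where
  "complex_surface M A \<longleftrightarrow>
     Hausdorff_space M \<and> second_countable M \<and>
     (\<forall>c\<in>A. is_chart M c) \<and> (\<Union>c\<in>A. chart_dom c) = topspace M \<and>
     (\<forall>c\<in>A. \<forall>d\<in>A. holomorphic_map_on (coord c ` (chart_dom c \<inter> chart_dom d)) (transition c d))"

definition transition_deriv :: "'a chart \<Rightarrow> 'a chart \<Rightarrow> 'a \<Rightarrow> complex^2 \<Rightarrow> complex^2" where
  "transition_deriv c d p = frechet_derivative (transition c d) (at (coord c p))"

lemma J_transition:
  assumes "complex_surface M A" "c \<in> A" "d \<in> A" "p \<in> chart_dom c" "p \<in> chart_dom d"
  shows "transition_deriv c d p (J v) = J (transition_deriv c d p v)"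
proof -
  from assms obtain D where "(transition c d has_derivative D) (at (coord c p))"
    and D: "\<And>a v. D (a *s v) = a *s D v"
    unfolding complex_surface_def holomorphic_map_on_def by blast
  then have "transition_deriv c d p = D"
    by (simp add: transition_deriv_def frechet_derivative_at[symmetric])
  then show ?thesis by (simp add: J_def D)
qed

definition smooth_function :: "'a chart set \<Rightarrow> ('a \<Rightarrow> real) \<Rightarrow> bool" where
  "smooth_function A f \<longleftrightarrow> (\<forall>c\<in>A. smooth_on (chart_img c) (f \<circ> chart_point c))"

text \<open>
  A covariant 2-tensor field on the surface is a family \<open>g\<close> of coordinate expressions: \<open>g c\<close>
  is its expression in the chart \<open>c\<close>, and expressions in overlapping charts are related by
  pullback along the transition maps.
\<close>

type_synonym 'a tensor2_field = "'a chart \<Rightarrow> (complex^2) tensor2"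

definition riemannian_metric :: "'a chart set \<Rightarrow> 'a tensor2_field \<Rightarrow> bool" where
  "riemannian_metric A g \<longleftrightarrow>
     (\<forall>c\<in>A. (\<forall>x\<in>chart_img c. inner_product_form (g c x)) \<and>
             (\<forall>u v. smooth_on (chart_img c) (\<lambda>x. g c x u v))) \<and>
     (\<forall>c\<in>A. \<forall>d\<in>A. \<forall>p\<in>chart_dom c \<inter> chart_dom d. \<forall>u v.
        g c (coord c p) u v =
        g d (coord d p) (transition_deriv c d p u) (transition_deriv c d p v))"

definition geodesic :: "'a topology \<Rightarrow> 'a chart set \<Rightarrow> 'a tensor2_field \<Rightarrow> (real \<Rightarrow> 'a) \<Rightarrow> bool" where
  "geodesic M A g \<gamma> \<longleftrightarrow> continuous_map euclideanreal M \<gamma> \<and>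
     (\<forall>c\<in>A. \<exists>\<sigma>'. \<forall>t. \<gamma> t \<in> chart_dom c \<longrightarrow>
        ((coord c \<circ> \<gamma>) has_vector_derivative \<sigma>' t) (at t) \<and>
        (\<sigma>' has_vector_derivative - christoffel (g c) (coord c (\<gamma> t)) (\<sigma>' t) (\<sigma>' t)) (at t))"

text \<open>
  Completeness is geodesic completeness: every initial velocity is that of a geodesic defined on
  the whole real line. This formulation does not require the surface to be connected.
\<close>

definition complete_metric :: "'a topology \<Rightarrow> 'a chart set \<Rightarrow> 'a tensor2_field \<Rightarrow> bool" where
  "complete_metric M A g \<longleftrightarrow>
     (\<forall>c\<in>A. \<forall>p\<in>chart_dom c. \<forall>v. \<exists>\<gamma>. geodesic M A g \<gamma> \<and> \<gamma> 0 = p \<and>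
        ((coord c \<circ> \<gamma>) has_vector_derivative v) (at 0))"

definition gradient_shrinking_soliton ::
    "'a topology \<Rightarrow> 'a chart set \<Rightarrow> 'a tensor2_field \<Rightarrow> ('a \<Rightarrow> real) \<Rightarrow> bool" where
  "gradient_shrinking_soliton M A g f \<longleftrightarrow>
     riemannian_metric A g \<and> complete_metric M A g \<and> smooth_function A f \<and>
     (\<forall>c\<in>A. \<forall>x\<in>chart_img c. \<forall>u v.
        ricci (g c) x u v + hessian (g c) (f \<circ> chart_point c) x u v = 1/2 * g c x u v)"

definition J_invariant :: "'a chart set \<Rightarrow> 'a tensor2_field \<Rightarrow> bool" where
  "J_invariant A T \<longleftrightarrow> (\<forall>c\<in>A. \<forall>x\<in>chart_img c. \<forall>u v. T c x (J u) (J v) = T c x u v)"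

definition hermitian_form :: "'a tensor2_field \<Rightarrow> 'a tensor2_field" where
  "hermitian_form g c x u v = g c x u (J v)"

end

theory Submission
  imports Defs
begin

text \<open>
  Write \<open>G = \<nabla>f\<close>. Commuting derivatives of \<open>f\<close> in \<open>\<nabla>\<^sup>2 f = g/2 - Ric\<close> gives
  \<open>(\<nabla>\<^sub>u Ric)(v, w) - (\<nabla>\<^sub>v Ric)(u, w) = g(R(u, v)w, G)\<close>, so \<open>(\<nabla>\<^sub>u Ric)(v, G)\<close> is symmetric in
  \<open>u, v\<close> and, with the contracted Bianchi identity, \<open>div Ric = Ric(G, \<cdot>)\<close>. For a unitary frame
  \<open>e\<close> the first fact yields \<open>\<Sum>\<^sub>e (\<nabla>\<^sub>e Ric)(Je, G) = 0\<close> and the second yields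
  \<open>\<Sum>\<^sub>e (\<nabla>\<^sub>e Ric)(e, JG) = Ric(JG, G) = 0\<close>. Since \<open>Ric\<close> is \<open>J\<close>-invariant, the sum of the two is an
  expression in \<open>\<nabla>J\<close> alone, namely
  \<open>\<Sum>\<^sub>e Ric((\<nabla>\<^sub>e J)e, G) + Ric(e, (\<nabla>\<^sub>e J)G) = 0\<close>. Integrability expresses \<open>\<nabla>J\<close> by \<open>d\<omega>\<close>, and in
  real dimension 4 this scalar equation is exactly the vanishing of the only component of
  \<open>Ric\<^sub>0(G, \<cdot>) \<and> d\<omega>\<close>.
\<close>

section \<open>Calculus of smooth functions\<close>

lemma has_derivative_dir_deriv:
  "F differentiable (at x) \<Longrightarrow> (F has_derivative dir_deriv F x) (at x)"
  unfolding dir_deriv_def[abs_def] by (simp add: frechet_derivative_works)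

lemma dir_deriv_eqI: "(F has_derivative F') (at x) \<Longrightarrow> dir_deriv F x = F'"
  unfolding dir_deriv_def[abs_def] by (metis frechet_derivative_at)

lemma dir_deriv_const [simp]: "dir_deriv (\<lambda>_. c) x v = 0"
  by (simp add: dir_deriv_def)

lemma linear_dir_deriv: "F differentiable (at x) \<Longrightarrow> linear (dir_deriv F x)"
  using has_derivative_dir_deriv has_derivative_linear by blast

lemma differentiable_cong_open:
  assumes "open S" "x \<in> S" "\<And>y. y \<in> S \<Longrightarrow> F y = G y"
  shows "F differentiable (at x) \<longleftrightarrow> G differentiable (at x)"
  using assms has_derivative_transform_within_open[of F _ x UNIV S G]
    has_derivative_transform_within_open[of G _ x UNIV S F]
  unfolding differentiable_def by metis

lemma dir_deriv_cong_open:
  assumes "open S" "x \<in> S" "\<And>y. y \<in> S \<Longrightarrow> F y = G y" "F differentiable (at x)"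
  shows "dir_deriv F x v = dir_deriv G x v"
  using dir_deriv_eqI[OF has_derivative_transform_within_open[OF has_derivative_dir_deriv[OF assms(4)] assms(1-3)]]
  by simp

text \<open>Puts the recursion in terms of \<open>dir_deriv\<close>, for which the calculus rules
  below are stated; the original equation then leaves the simplifier.\<close>

lemma Ck_on_Suc_iff:
  "Ck_on (Suc k) S F \<longleftrightarrow> (\<forall>x\<in>S. F differentiable (at x)) \<and> (\<forall>v. Ck_on k S (\<lambda>x. dir_deriv F x v))"
  by (simp add: dir_deriv_def)

declare Ck_on.simps(2) [simp del]

text \<open>A derivative at a point depends on values in a neighbourhood of it; openness keeps such
  a neighbourhood inside \<open>S\<close>.\<close>

lemma Ck_on_cong:
  assumes S: "open S" and eq: "\<And>x. x \<in> S \<Longrightarrow> F x = G x" and F: "Ck_on k S F"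
  shows "Ck_on k S G"
  using eq F
proof (induction k arbitrary: F G)
  case 0
  then show ?case by (simp cong: continuous_on_cong)
next
  case (Suc k)
  have "G differentiable (at x)" if "x \<in> S" for x
    using Suc.prems that differentiable_cong_open[OF S that, of F G] by (auto simp: Ck_on_Suc_iff)
  moreover have "Ck_on k S (\<lambda>x. dir_deriv G x v)" for v
    by (rule Suc.IH[of "\<lambda>x. dir_deriv F x v"], rule dir_deriv_cong_open[OF S])
      (use Suc.prems in \<open>auto simp: Ck_on_Suc_iff\<close>)
  ultimately show ?case by (simp add: Ck_on_Suc_iff)
qed

lemma Ck_on_lower: "Ck_on (Suc k) S F \<Longrightarrow> Ck_on k S F"
proof (induction k arbitrary: F)
  case 0
  then show ?case
    by (auto simp: Ck_on_Suc_iff differentiable_imp_continuous_within continuous_at_imp_continuous_on)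
next
  case (Suc k)
  then show ?case by (simp add: Ck_on_Suc_iff[of "Suc k"] Ck_on_Suc_iff[of k])
qed

lemma smooth_on_differentiable: "smooth_on S F \<Longrightarrow> x \<in> S \<Longrightarrow> F differentiable (at x)"
  unfolding smooth_on_def by (metis Ck_on_Suc_iff)

lemma smooth_on_dir_deriv: "smooth_on S F \<Longrightarrow> smooth_on S (\<lambda>x. dir_deriv F x v)"
  unfolding smooth_on_def by (metis Ck_on_Suc_iff)

lemma smooth_on_continuous_on: "smooth_on S F \<Longrightarrow> continuous_on S F"
  unfolding smooth_on_def by (metis Ck_on.simps(1))

lemma smooth_on_cong:
  "open S \<Longrightarrow> (\<And>x. x \<in> S \<Longrightarrow> F x = G x) \<Longrightarrow> smooth_on S F \<Longrightarrow> smooth_on S G"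
  unfolding smooth_on_def using Ck_on_cong by blast

lemma Ck_on_const: "Ck_on k S (\<lambda>_. c)"
  by (induction k arbitrary: c) (simp_all add: Ck_on_Suc_iff)

lemma smooth_on_const [simp]: "smooth_on S (\<lambda>_. c)"
  by (simp add: smooth_on_def Ck_on_const)

section \<open>Rules for directional derivatives\<close>

lemma dir_deriv_add:
  "F differentiable (at x) \<Longrightarrow> G differentiable (at x) \<Longrightarrow>
   dir_deriv (\<lambda>y. F y + G y) x v = dir_deriv F x v + dir_deriv G x v"
  by (subst dir_deriv_eqI[OF has_derivative_add[OF has_derivative_dir_deriv has_derivative_dir_deriv]]) auto

lemma dir_deriv_diff:
  "F differentiable (at x) \<Longrightarrow> G differentiable (at x) \<Longrightarrow>
   dir_deriv (\<lambda>y. F y - G y) x v = dir_deriv F x v - dir_deriv G x v"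
  by (subst dir_deriv_eqI[OF has_derivative_diff[OF has_derivative_dir_deriv has_derivative_dir_deriv]]) auto

lemma dir_deriv_sum:
  "(\<And>i. i \<in> I \<Longrightarrow> F i differentiable (at x)) \<Longrightarrow>
   dir_deriv (\<lambda>y. \<Sum>i\<in>I. F i y) x v = (\<Sum>i\<in>I. dir_deriv (F i) x v)"
  by (subst dir_deriv_eqI[OF has_derivative_sum[OF has_derivative_dir_deriv]]) auto

lemma (in bounded_bilinear) dir_deriv_prod:
  "F differentiable (at x) \<Longrightarrow> G differentiable (at x) \<Longrightarrow>
   dir_deriv (\<lambda>y. prod (F y) (G y)) x v = prod (F x) (dir_deriv G x v) + prod (dir_deriv F x v) (G x)"
  by (subst dir_deriv_eqI[OF FDERIV[OF has_derivative_dir_deriv has_derivative_dir_deriv]]) auto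

lemma (in bounded_bilinear) differentiable_prod:
  "F differentiable (at x) \<Longrightarrow> G differentiable (at x) \<Longrightarrow> (\<lambda>y. prod (F y) (G y)) differentiable (at x)"
  unfolding differentiable_def using FDERIV by blast

lemma (in bounded_linear) dir_deriv_image:
  "F differentiable (at x) \<Longrightarrow> dir_deriv (\<lambda>y. f (F y)) x v = f (dir_deriv F x v)"
  by (subst dir_deriv_eqI[OF has_derivative[OF has_derivative_dir_deriv]]) auto

section \<open>Closure of smoothness under algebraic operations\<close>

lemma Ck_on_add:
  assumes "open S" "Ck_on k S F" "Ck_on k S G"
  shows "Ck_on k S (\<lambda>x. F x + G x)"
  using assms(2,3)
proof (induction k arbitrary: F G)
  case (Suc k)
  have "Ck_on k S (\<lambda>x. dir_deriv F x v + dir_deriv G x v)" for v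
    using Suc by (simp add: Ck_on_Suc_iff)
  then have "Ck_on k S (\<lambda>x. dir_deriv (\<lambda>x. F x + G x) x v)" for v
    by (rule Ck_on_cong[OF assms(1), rotated]) (use Suc.prems in \<open>auto simp: Ck_on_Suc_iff dir_deriv_add\<close>)
  then show ?case using Suc.prems by (auto simp: Ck_on_Suc_iff)
qed (simp add: continuous_on_add)

lemma smooth_on_add:
  "open S \<Longrightarrow> smooth_on S F \<Longrightarrow> smooth_on S G \<Longrightarrow> smooth_on S (\<lambda>x. F x + G x)"
  by (simp add: smooth_on_def Ck_on_add)

text \<open>The Leibniz rule gives two products to which the induction hypothesis applies once the
  undifferentiated factor is lowered by one order.\<close>

lemma (in bounded_bilinear) Ck_on_prod:
  assumes "open S" "Ck_on k S F" "Ck_on k S G"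
  shows "Ck_on k S (\<lambda>x. prod (F x) (G x))"
  using assms(2,3)
proof (induction k arbitrary: F G)
  case (Suc k)
  have "Ck_on k S (\<lambda>x. prod (F x) (dir_deriv G x v) + prod (dir_deriv F x v) (G x))" for v
    using Suc Ck_on_lower[OF Suc.prems(1)] Ck_on_lower[OF Suc.prems(2)]
    by (intro Ck_on_add assms(1)) (simp_all add: Ck_on_Suc_iff)
  then have "Ck_on k S (\<lambda>x. dir_deriv (\<lambda>x. prod (F x) (G x)) x v)" for v
    by (rule Ck_on_cong[OF assms(1), rotated]) (use Suc.prems in \<open>auto simp: Ck_on_Suc_iff dir_deriv_prod\<close>)
  then show ?case using Suc.prems by (auto simp: Ck_on_Suc_iff differentiable_prod)
qed (simp add: continuous_on)

lemma (in bounded_bilinear) smooth_on_prod: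
  "open S \<Longrightarrow> smooth_on S F \<Longrightarrow> smooth_on S G \<Longrightarrow> smooth_on S (\<lambda>x. prod (F x) (G x))"
  by (simp add: smooth_on_def Ck_on_prod)

lemmas smooth_on_mult = bounded_bilinear.smooth_on_prod[OF bounded_bilinear_mult]
  and smooth_on_scaleR = bounded_bilinear.smooth_on_prod[OF bounded_bilinear_scaleR]
  and smooth_on_inner = bounded_bilinear.smooth_on_prod[OF bounded_bilinear_inner]

lemma smooth_on_diff:
  "open S \<Longrightarrow> smooth_on S F \<Longrightarrow> smooth_on S G \<Longrightarrow> smooth_on S (\<lambda>x. F x - G x)"
  using smooth_on_add[of S F "\<lambda>x. (-1) *\<^sub>R G x"] smooth_on_scaleR[of S "\<lambda>_. -1" G] by simp

lemma smooth_on_sum: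
  "open S \<Longrightarrow> (\<And>i. i \<in> I \<Longrightarrow> smooth_on S (F i)) \<Longrightarrow> smooth_on S (\<lambda>x. \<Sum>i\<in>I. F i x)"
  by (induction I rule: infinite_finite_induct) (simp_all add: smooth_on_add)

text \<open>The derivative of the inverse is a product of \<open>inverse F\<close> (twice) and a
  derivative of \<open>F\<close>, so the induction hypothesis and the product rule suffice.\<close>

lemma Ck_on_inverse:
  fixes F :: "'e::euclidean_space \<Rightarrow> real"
  assumes "open S" "Ck_on k S F" "\<And>x. x \<in> S \<Longrightarrow> F x \<noteq> 0"
  shows "Ck_on k S (\<lambda>x. inverse (F x))"
  using assms(2)
proof (induction k)
  case 0
  then show ?case using assms(3) by (simp add: continuous_on_inverse)
next
  case (Suc k)
  have *: "((\<lambda>x. inverse (F x)) has_derivative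
      (\<lambda>v. - (inverse (F x) * dir_deriv F x v * inverse (F x)))) (at x)" if "x \<in> S" for x
    by (rule Deriv.has_derivative_inverse[OF _ has_derivative_dir_deriv])
      (use Suc.prems that assms(3) in \<open>auto simp: Ck_on_Suc_iff\<close>)
  have **: "Ck_on k S (\<lambda>x. (-1) * (inverse (F x) * dir_deriv F x v * inverse (F x)))" for v
    using Suc Ck_on_lower[OF Suc.prems]
    by (intro bounded_bilinear.Ck_on_prod[OF bounded_bilinear_mult assms(1)]) (simp_all add: Ck_on_Suc_iff Ck_on_const)
  have "Ck_on k S (\<lambda>x. dir_deriv (\<lambda>x. inverse (F x)) x v)" for v
    by (rule Ck_on_cong[OF assms(1) _ **[of v]]) (simp add: dir_deriv_eqI[OF *])
  then show ?case using * by (auto simp: Ck_on_Suc_iff differentiable_def)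
qed

lemma smooth_on_divide:
  fixes F G :: "'e::euclidean_space \<Rightarrow> real"
  shows "open S \<Longrightarrow> smooth_on S F \<Longrightarrow> smooth_on S G \<Longrightarrow> (\<And>x. x \<in> S \<Longrightarrow> G x \<noteq> 0) \<Longrightarrow>
    smooth_on S (\<lambda>x. F x / G x)"
  unfolding divide_inverse by (intro smooth_on_mult) (simp_all add: smooth_on_def Ck_on_inverse)

section \<open>Symmetry of second derivatives\<close>

text \<open>The mean value theorem is used twice: along \<open>u\<close> for the first difference
  \<open>H\<close>, then along \<open>v\<close> for the derivative of \<open>F\<close> in direction
  \<open>u\<close>.\<close>

lemma second_difference_mean_value:
  fixes F :: "'e::euclidean_space \<Rightarrow> real"
  assumes t: "0 < t"
    and sub: "\<And>r q. r \<in> {0..t} \<Longrightarrow> q \<in> {0..t} \<Longrightarrow> x + r *\<^sub>R u + q *\<^sub>R v \<in> S"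
    and dF: "\<And>y. y \<in> S \<Longrightarrow> F differentiable (at y)"
    and dG: "\<And>y. y \<in> S \<Longrightarrow> (\<lambda>y. dir_deriv F y u) differentiable (at y)"
  obtains r q where "r \<in> {0..t}" "q \<in> {0..t}"
    "F (x + t *\<^sub>R u + t *\<^sub>R v) - F (x + t *\<^sub>R u) - F (x + t *\<^sub>R v) + F x =
     t\<^sup>2 * dir_deriv (\<lambda>y. dir_deriv F y u) (x + r *\<^sub>R u + q *\<^sub>R v) v"
proof -
  define H where "H r = F (x + r *\<^sub>R u + t *\<^sub>R v) - F (x + r *\<^sub>R u)" for r
  have aff: "((\<lambda>r. p + r *\<^sub>R w) has_derivative (\<lambda>s. s *\<^sub>R w)) (at r)" for p w :: 'e and r
    by (auto intro!: derivative_eq_intros)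
  have line: "((\<lambda>r. K (p + r *\<^sub>R w)) has_real_derivative dir_deriv K (p + r *\<^sub>R w) w) (at r)"
    if "K differentiable (at (p + r *\<^sub>R w))" for K :: "'e \<Rightarrow> real" and p w r
  proof -
    have "((\<lambda>r. K (p + r *\<^sub>R w)) has_derivative (\<lambda>s. dir_deriv K (p + r *\<^sub>R w) (s *\<^sub>R w))) (at r)"
      using has_derivative_compose[OF aff has_derivative_dir_deriv[OF that]] .
    moreover have "(\<lambda>s. dir_deriv K (p + r *\<^sub>R w) (s *\<^sub>R w)) = (\<lambda>s. dir_deriv K (p + r *\<^sub>R w) w * s)"
      using linear_scale[OF linear_dir_deriv[OF that]] by (auto simp: mult.commute)
    ultimately show ?thesis by (simp add: has_field_derivative_def)
  qed
  have dH: "(H has_real_derivative dir_deriv F (x + t *\<^sub>R v + r *\<^sub>R u) u - dir_deriv F (x + r *\<^sub>R u) u) (at r)"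
    if "0 \<le> r" "r \<le> t" for r
  proof -
    have 1: "x + t *\<^sub>R v + r *\<^sub>R u \<in> S" using sub[of r t] that t by (simp add: ac_simps)
    have 2: "x + r *\<^sub>R u \<in> S" using sub[of r 0] that t by simp
    have "((\<lambda>r. F (x + t *\<^sub>R v + r *\<^sub>R u) - F (x + r *\<^sub>R u)) has_real_derivative
        dir_deriv F (x + t *\<^sub>R v + r *\<^sub>R u) u - dir_deriv F (x + r *\<^sub>R u) u) (at r)"
      using dF 1 2 by (intro DERIV_diff line) auto
    then show ?thesis by (simp add: H_def[abs_def] ac_simps)
  qed
  obtain r where r: "0 < r" "r < t" and
    H: "H t - H 0 = (t - 0) * (dir_deriv F (x + t *\<^sub>R v + r *\<^sub>R u) u - dir_deriv F (x + r *\<^sub>R u) u)"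
    using MVT2[OF t dH] by auto
  have dK: "((\<lambda>q. dir_deriv F (x + r *\<^sub>R u + q *\<^sub>R v) u) has_real_derivative
      dir_deriv (\<lambda>y. dir_deriv F y u) (x + r *\<^sub>R u + q *\<^sub>R v) v) (at q)" if "0 \<le> q" "q \<le> t" for q
    using line[OF dG[OF sub[of r q]]] that r by simp
  obtain q where q: "0 < q" "q < t" and
    K: "dir_deriv F (x + r *\<^sub>R u + t *\<^sub>R v) u - dir_deriv F (x + r *\<^sub>R u + 0 *\<^sub>R v) u =
      (t - 0) * dir_deriv (\<lambda>y. dir_deriv F y u) (x + r *\<^sub>R u + q *\<^sub>R v) v"
    using MVT2[OF t dK] by auto
  show ?thesis
  proof
    show "r \<in> {0..t}" "q \<in> {0..t}" using r q by auto
    show "F (x + t *\<^sub>R u + t *\<^sub>R v) - F (x + t *\<^sub>R u) - F (x + t *\<^sub>R v) + F x =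
      t\<^sup>2 * dir_deriv (\<lambda>y. dir_deriv F y u) (x + r *\<^sub>R u + q *\<^sub>R v) v"
      using H K by (simp add: H_def power2_eq_square ac_simps)
  qed
qed

text \<open>The second difference is symmetric in \<open>u\<close> and \<open>v\<close>, so the two
  mixed derivatives agree at two points of an arbitrarily small parallelogram at \<open>x\<close>.
  Their continuity at \<open>x\<close> does the rest.\<close>

lemma dir_deriv_commute_real:
  fixes F :: "'e::euclidean_space \<Rightarrow> real"
  assumes S: "open S" "x \<in> S" and F: "smooth_on S F"
  shows "dir_deriv (\<lambda>y. dir_deriv F y u) x v = dir_deriv (\<lambda>y. dir_deriv F y v) x u"
proof -
  let ?A = "\<lambda>y. dir_deriv (\<lambda>y. dir_deriv F y u) y v" and ?B = "\<lambda>y. dir_deriv (\<lambda>y. dir_deriv F y v) y u"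
  have cont: "isCont ?A x" "isCont ?B x"
    using smooth_on_continuous_on[OF smooth_on_dir_deriv[OF smooth_on_dir_deriv[OF F]]] S
    by (simp_all add: continuous_on_eq_continuous_at)
  have "\<bar>?A x - ?B x\<bar> \<le> e" if "e > 0" for e
  proof -
    have e2: "e / 2 > 0" using that by simp
    obtain d1 where d1: "d1 > 0" "\<And>y. dist y x < d1 \<Longrightarrow> dist (?A y) (?A x) < e / 2"
      using cont(1)[unfolded continuous_at_eps_delta, rule_format, OF e2] by auto
    obtain d2 where d2: "d2 > 0" "\<And>y. dist y x < d2 \<Longrightarrow> dist (?B y) (?B x) < e / 2"
      using cont(2)[unfolded continuous_at_eps_delta, rule_format, OF e2] by auto
    obtain d3 where d3: "d3 > 0" "ball x d3 \<subseteq> S"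
      using S open_contains_ball by blast
    define d where "d = min d1 (min d2 d3)"
    have d: "d > 0" "ball x d \<subseteq> S" using d1 d2 d3 by (auto simp: d_def)
    have dA: "dist (?A y) (?A x) < e / 2" if "dist y x < d" for y using d1(2) that by (simp add: d_def)
    have dB: "dist (?B y) (?B x) < e / 2" if "dist y x < d" for y using d2(2) that by (simp add: d_def)
    \<comment> \<open>This keeps the parallelogram with sides \<open>t *\<^sub>R u\<close> and
      \<open>t *\<^sub>R v\<close> inside the ball of radius \<open>d\<close>; the summand 1 covers
      \<open>u = v = 0\<close>.\<close>
    define t where "t = d / (norm u + norm v + 1)"
    have np: "norm u + norm v + 1 > 0" by (smt (verit) norm_ge_zero)
    then have t: "t > 0" using d by (simp add: t_def)
    have near: "dist (x + r *\<^sub>R u + q *\<^sub>R v) x < d" if "r \<in> {0..t}" "q \<in> {0..t}" for r q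
    proof -
      have "norm (r *\<^sub>R u + q *\<^sub>R v) \<le> r * norm u + q * norm v"
        using norm_triangle_ineq[of "r *\<^sub>R u" "q *\<^sub>R v"] that by simp
      also have "\<dots> \<le> t * norm u + t * norm v"
        using that by (intro add_mono mult_right_mono) auto
      also have "\<dots> < t * (norm u + norm v + 1)" using t by (simp add: algebra_simps)
      also have "\<dots> = d" using np by (simp add: t_def)
      finally show ?thesis by (simp add: dist_norm add.assoc)
    qed
    then have inS: "x + r *\<^sub>R u + q *\<^sub>R v \<in> S" if "r \<in> {0..t}" "q \<in> {0..t}" for r q
      using that d(2) by (auto simp: dist_commute)
    have inS': "x + r *\<^sub>R v + q *\<^sub>R u \<in> S" if "r \<in> {0..t}" "q \<in> {0..t}" for r q
      using inS[of q r] that by (simp add: ac_simps)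
    note diff = smooth_on_differentiable[OF F] smooth_on_differentiable[OF smooth_on_dir_deriv[OF F]]
    obtain r q where 1: "r \<in> {0..t}" "q \<in> {0..t}"
      "F (x + t *\<^sub>R u + t *\<^sub>R v) - F (x + t *\<^sub>R u) - F (x + t *\<^sub>R v) + F x = t\<^sup>2 * ?A (x + r *\<^sub>R u + q *\<^sub>R v)"
      using second_difference_mean_value[OF t inS diff] by blast
    obtain r' q' where 2: "r' \<in> {0..t}" "q' \<in> {0..t}"
      "F (x + t *\<^sub>R v + t *\<^sub>R u) - F (x + t *\<^sub>R v) - F (x + t *\<^sub>R u) + F x = t\<^sup>2 * ?B (x + r' *\<^sub>R v + q' *\<^sub>R u)"
      using second_difference_mean_value[OF t inS' diff] by blast
    have "t\<^sup>2 * ?A (x + r *\<^sub>R u + q *\<^sub>R v) = t\<^sup>2 * ?B (x + q' *\<^sub>R u + r' *\<^sub>R v)"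
      using 1(3) 2(3) by (simp only: add.assoc add.commute[of "t *\<^sub>R v"] add.commute[of "r' *\<^sub>R v"])
    then have "?A (x + r *\<^sub>R u + q *\<^sub>R v) = ?B (x + q' *\<^sub>R u + r' *\<^sub>R v)" using t by simp
    moreover have "dist (?A (x + r *\<^sub>R u + q *\<^sub>R v)) (?A x) < e / 2" using dA near 1 by blast
    moreover have "dist (?B (x + q' *\<^sub>R u + r' *\<^sub>R v)) (?B x) < e / 2" using dB near 2 by blast
    ultimately show ?thesis unfolding dist_real_def by linarith
  qed
  then have "\<bar>?A x - ?B x\<bar> \<le> 0" using field_le_epsilon[of "\<bar>?A x - ?B x\<bar>" 0] by simp
  then show ?thesis by simp
qed

lemma dir_deriv_commute:
  fixes F :: "'e::euclidean_space \<Rightarrow> 'b::euclidean_space"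
  assumes S: "open S" "x \<in> S" and F: "smooth_on S F"
  shows "dir_deriv (\<lambda>y. dir_deriv F y u) x v = dir_deriv (\<lambda>y. dir_deriv F y v) x u"
proof (rule euclidean_eqI)
  fix b :: 'b
  have 1: "dir_deriv G y w \<bullet> b = dir_deriv (\<lambda>y. G y \<bullet> b) y w" if "G differentiable (at y)" for G :: "'e \<Rightarrow> 'b" and y w
    using bounded_linear.dir_deriv_image[OF bounded_linear_inner_left that] by simp
  have 2: "dir_deriv (\<lambda>y. dir_deriv F y u) x v \<bullet> b = dir_deriv (\<lambda>y. dir_deriv (\<lambda>y. F y \<bullet> b) y u) x v" for u v
    using S smooth_on_differentiable[OF smooth_on_dir_deriv[OF F]] smooth_on_differentiable[OF F]
      differentiable_inner[OF smooth_on_differentiable[OF smooth_on_dir_deriv[OF F]] differentiable_const]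
    by (subst 1) (auto intro!: dir_deriv_cong_open[OF S] simp: 1)
  show "dir_deriv (\<lambda>y. dir_deriv F y u) x v \<bullet> b = dir_deriv (\<lambda>y. dir_deriv F y v) x u \<bullet> b"
    unfolding 2 by (intro dir_deriv_commute_real[OF S] smooth_on_inner F) (auto simp: S)
qed


section \<open>Tensor fields and frames\<close>

text \<open>Reduces a field of linear maps applied to a varying vector to its values on constant
  basis vectors; oriented so that basis sums collapse under rewriting.\<close>

lemma linear_field_expand:
  assumes "linear L"
  shows "(\<Sum>b\<in>Basis. (v \<bullet> b) *\<^sub>R L (b::'a::euclidean_space)) = L v"
proof -
  have "L v = L (\<Sum>b\<in>Basis. (v \<bullet> b) *\<^sub>R b)" by (simp add: euclidean_representation)
  then show ?thesis by (simp add: linear_sum[OF assms] linear_scale[OF assms] o_def)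
qed

lemma linear_dir_deriv_field:
  assumes "open S" "x \<in> S" and lin: "\<And>y. y \<in> S \<Longrightarrow> linear (B y)"
    and B: "\<And>v. (\<lambda>y. B y v) differentiable (at x)"
  shows "linear (\<lambda>v. dir_deriv (\<lambda>y. B y v) x u)"
proof (rule linearI)
  fix v w c
  have "dir_deriv (\<lambda>y. B y (v + w)) x u = dir_deriv (\<lambda>y. B y v + B y w) x u"
    using assms by (intro dir_deriv_cong_open) (auto simp: linear_add)
  then show "dir_deriv (\<lambda>y. B y (v + w)) x u = dir_deriv (\<lambda>y. B y v) x u + dir_deriv (\<lambda>y. B y w) x u"
    by (simp add: dir_deriv_add B)
  have "dir_deriv (\<lambda>y. B y (c *\<^sub>R v)) x u = dir_deriv (\<lambda>y. c *\<^sub>R B y v) x u"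
    using assms by (intro dir_deriv_cong_open) (auto simp: linear_scale)
  then show "dir_deriv (\<lambda>y. B y (c *\<^sub>R v)) x u = c *\<^sub>R dir_deriv (\<lambda>y. B y v) x u"
    by (simp add: bounded_linear.dir_deriv_image[OF bounded_linear_scaleR_right] B)
qed

text \<open>In a basis, \<open>B y (s y)\<close> is a finite sum of components of \<open>s\<close>
  times values of \<open>B\<close> on constant vectors, and the ordinary product rule
  applies.\<close>

lemma
  fixes B :: "'e::euclidean_space \<Rightarrow> 'a::euclidean_space \<Rightarrow> 'b::real_normed_vector"
  assumes S: "open S" "x \<in> S" and lin: "\<And>y. y \<in> S \<Longrightarrow> linear (B y)"
    and B: "\<And>v. (\<lambda>y. B y v) differentiable (at x)" and s: "s differentiable (at x)"
  shows differentiable_field: "(\<lambda>y. B y (s y)) differentiable (at x)"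
    and dir_deriv_field: "dir_deriv (\<lambda>y. B y (s y)) x u =
      dir_deriv (\<lambda>y. B y (s x)) x u + B x (dir_deriv s x u)"
proof -
  let ?E = "\<lambda>y. \<Sum>b\<in>Basis. (s y \<bullet> b) *\<^sub>R B y b"
  have eq: "?E y = B y (s y)" if "y \<in> S" for y
    using linear_field_expand[OF lin[OF that]] by simp
  note scaleR = bounded_bilinear.differentiable_prod[OF bounded_bilinear_scaleR]
    bounded_bilinear.dir_deriv_prod[OF bounded_bilinear_scaleR]
  have sb: "(\<lambda>y. s y \<bullet> b) differentiable (at x)"
    "dir_deriv (\<lambda>y. s y \<bullet> b) x u = dir_deriv s x u \<bullet> b" for b
    using s bounded_linear.dir_deriv_image[OF bounded_linear_inner_left s] by auto
  have E: "?E differentiable (at x)"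
    by (intro differentiable_sum ballI scaleR(1) sb(1) B) auto
  then show "(\<lambda>y. B y (s y)) differentiable (at x)"
    using differentiable_cong_open[OF S eq] by simp
  have "dir_deriv (\<lambda>y. B y (s y)) x u = dir_deriv ?E x u"
    using dir_deriv_cong_open[OF S eq E] by simp
  also have "\<dots> = (\<Sum>b\<in>Basis. (s x \<bullet> b) *\<^sub>R dir_deriv (\<lambda>y. B y b) x u) +
      (\<Sum>b\<in>Basis. (dir_deriv s x u \<bullet> b) *\<^sub>R B x b)"
    by (simp add: dir_deriv_sum scaleR sb B sum.distrib)
  finally show "dir_deriv (\<lambda>y. B y (s y)) x u =
      dir_deriv (\<lambda>y. B y (s x)) x u + B x (dir_deriv s x u)"
    using linear_field_expand[OF linear_dir_deriv_field[OF S lin B]] linear_field_expand[OF lin[OF S(2)]]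
    by simp
qed

lemma smooth_on_field:
  fixes B :: "'e::euclidean_space \<Rightarrow> 'a::euclidean_space \<Rightarrow> 'b::real_normed_vector"
  assumes S: "open S" and lin: "\<And>y. y \<in> S \<Longrightarrow> linear (B y)"
    and B: "\<And>v. smooth_on S (\<lambda>y. B y v)" and s: "smooth_on S s"
  shows "smooth_on S (\<lambda>y. B y (s y))"
proof (rule smooth_on_cong[OF S])
  show "(\<Sum>b\<in>Basis. (s y \<bullet> b) *\<^sub>R B y b) = B y (s y)" if "y \<in> S" for y
    using linear_field_expand[OF lin[OF that]] by simp
  show "smooth_on S (\<lambda>y. \<Sum>b\<in>Basis. (s y \<bullet> b) *\<^sub>R B y b)"
    by (intro smooth_on_sum smooth_on_scaleR smooth_on_inner S B s smooth_on_const)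
qed

lemma inner_product_form_linear:
  assumes "inner_product_form q"
  shows "linear (q u)" "linear (\<lambda>u. q u v)"
  using assms by (auto simp: inner_product_form_def bilinear_def)

lemma inner_product_form_eqI:
  assumes q: "inner_product_form q" and eq: "\<And>w. q u w = q v w"
  shows "u = v"
proof -
  have "q (u - v) (u - v) = 0"
    using linear_diff[OF inner_product_form_linear(2)[OF q]] eq by simp
  then show ?thesis using q unfolding inner_product_form_def by (metis eq_iff_diff_eq_0 less_irrefl)
qed

text \<open>The expansion formula of an orthonormal basis is taken as the definition, since it is
  what turns traces into sums over \<open>E\<close>.\<close>

definition frame :: "('e::euclidean_space \<Rightarrow> 'e \<Rightarrow> real) \<Rightarrow> 'e set \<Rightarrow> bool" where
  "frame q E \<longleftrightarrow> finite E \<and> (\<forall>v. v = (\<Sum>e\<in>E. q v e *\<^sub>R e))"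

text \<open>Each standard basis vector is expanded in the frame; exchanging the two sums then
  collapses the one over \<open>Basis\<close>.\<close>

lemma endo_trace_frame:
  assumes q: "inner_product_form q" and E: "frame q E" and T: "linear T"
  shows "endo_trace T = (\<Sum>e\<in>E. q (T e) e)"
proof -
  have "T b \<bullet> b = (\<Sum>e\<in>E. q b e * (T e \<bullet> b))" for b
  proof -
    have "b = (\<Sum>e\<in>E. q b e *\<^sub>R e)" using E unfolding frame_def by blast
    then have "T b = T (\<Sum>e\<in>E. q b e *\<^sub>R e)" by (rule arg_cong)
    also have "\<dots> = (\<Sum>e\<in>E. q b e *\<^sub>R T e)"
      by (simp add: linear_sum[OF T] linear_scale[OF T] o_def)
    finally show ?thesis by (simp add: inner_sum_left)
  qed
  then have "endo_trace T = (\<Sum>e\<in>E. \<Sum>b\<in>Basis. (T e \<bullet> b) * q b e)"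
    unfolding endo_trace_def by (subst sum.swap) (simp add: mult.commute)
  also have "\<dots> = (\<Sum>e\<in>E. q (T e) e)"
    using linear_field_expand[OF inner_product_form_linear(2)[OF q]] by simp
  finally show ?thesis .
qed

text \<open>Both sides are the same double sum of products of matrix entries.\<close>

lemma endo_trace_commute:
  fixes A B :: "'e::euclidean_space \<Rightarrow> 'e"
  assumes "linear A" "linear B"
  shows "endo_trace (\<lambda>z. A (B z)) = endo_trace (\<lambda>z. B (A z))"
proof -
  have "endo_trace (\<lambda>z. A (B z)) = (\<Sum>b\<in>Basis. \<Sum>c\<in>Basis. (B b \<bullet> c) * (A c \<bullet> b))"
    if "linear A" for A B :: "'e \<Rightarrow> 'e"
    unfolding endo_trace_def
    by (subst linear_field_expand[OF that, symmetric]) (simp add: inner_sum_left)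
  from this[OF assms(1), of B] this[OF assms(2), of A] show ?thesis
    by (subst (asm) (2) sum.swap) (simp add: mult.commute)
qed

section \<open>Curvature and the Bianchi identities\<close>

text \<open>This is \<open>(\<nabla>\<^sub>a T)(u, v)\<close>: for constant \<open>u\<close>, the
  vector \<open>christoffel h x a u\<close> is \<open>\<nabla>\<^sub>a u\<close>.\<close>

definition cov_deriv2 :: "'e::euclidean_space tensor2 \<Rightarrow> 'e tensor2 \<Rightarrow> 'e \<Rightarrow> 'e \<Rightarrow> 'e \<Rightarrow> 'e \<Rightarrow> real" where
  "cov_deriv2 h T x a u v =
     dir_deriv (\<lambda>y. T y u v) x a - T x (christoffel h x a u) v - T x u (christoffel h x a v)"

text \<open>This is \<open>(\<nabla>\<^sub>a R)(b, c) d\<close>, again with constant coordinate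
  fields as arguments.\<close>

definition cov_riemann :: "'e::euclidean_space tensor2 \<Rightarrow> 'e \<Rightarrow> 'e \<Rightarrow> 'e \<Rightarrow> 'e \<Rightarrow> 'e \<Rightarrow> 'e" where
  "cov_riemann h x a b c d =
     dir_deriv (\<lambda>y. riemann h y b c d) x a + christoffel h x a (riemann h x b c d)
     - riemann h x (christoffel h x a b) c d - riemann h x b (christoffel h x a c) d
     - riemann h x b c (christoffel h x a d)"

locale metric_chart =
  fixes S :: "'e::euclidean_space set" and h :: "'e tensor2"
  assumes open_S: "open S"
    and metric: "x \<in> S \<Longrightarrow> inner_product_form (h x)"
    and smooth_metric: "smooth_on S (\<lambda>x. h x u v)"
begin

abbreviation \<Gamma> where "\<Gamma> \<equiv> christoffel h"

lemma metric_linear: "x \<in> S \<Longrightarrow> linear (h x u)" "x \<in> S \<Longrightarrow> linear (\<lambda>u. h x u v)"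
  using inner_product_form_linear[OF metric] by auto

lemmas metric_simps =
  linear_add[OF metric_linear(1)] linear_add[OF metric_linear(2)]
  linear_diff[OF metric_linear(1)] linear_diff[OF metric_linear(2)]
  linear_neg[OF metric_linear(1)] linear_neg[OF metric_linear(2)]
  linear_scale[OF metric_linear(1)] linear_scale[OF metric_linear(2)]

lemma metric_commute: "x \<in> S \<Longrightarrow> h x u v = h x v u"
  using metric[of x] by (simp add: inner_product_form_def)

lemma differentiable_metric: "x \<in> S \<Longrightarrow> (\<lambda>x. h x u v) differentiable (at x)"
  using smooth_on_differentiable[OF smooth_metric] .

lemma dir_deriv_metric_commute:
  "x \<in> S \<Longrightarrow> dir_deriv (\<lambda>y. h y u v) x w = dir_deriv (\<lambda>y. h y v u) x w"
  by (rule dir_deriv_cong_open[OF open_S]) (auto intro: metric_commute differentiable_metric)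

lemma linear_dir_deriv_metric:
  assumes "x \<in> S"
  shows "linear (\<lambda>u. dir_deriv (\<lambda>y. h y u v) x w)" "linear (\<lambda>v. dir_deriv (\<lambda>y. h y u v) x w)"
    "linear (dir_deriv (\<lambda>y. h y u v) x)"
  using assms metric_linear differentiable_metric
  by (auto intro!: linear_dir_deriv linear_dir_deriv_field[OF open_S])

lemmas dir_deriv_metric_simps =
  linear_add[OF linear_dir_deriv_metric(1)] linear_add[OF linear_dir_deriv_metric(2)]
  linear_add[OF linear_dir_deriv_metric(3)] linear_scale[OF linear_dir_deriv_metric(1)]
  linear_scale[OF linear_dir_deriv_metric(2)] linear_scale[OF linear_dir_deriv_metric(3)]

section \<open>The Levi-Civita connection: symmetric, metric, bilinear\<close>

lemma koszul:
  assumes "x \<in> S"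
  shows "2 * h x (\<Gamma> x u v) w = dir_deriv (\<lambda>y. h y v w) x u + dir_deriv (\<lambda>y. h y u w) x v
    - dir_deriv (\<lambda>y. h y u v) x w"
proof -
  have lin: "linear (\<lambda>w. (dir_deriv (\<lambda>y. h y v w) x u + dir_deriv (\<lambda>y. h y u w) x v
      - dir_deriv (\<lambda>y. h y u v) x w) / 2)"
    by (rule linearI) (simp_all add: dir_deriv_metric_simps[OF assms] field_simps)
  show ?thesis unfolding christoffel_def
    by (subst sharp_works[of h x, OF metric[OF assms] lin]) simp
qed

lemma christoffel_commute:
  assumes "x \<in> S"
  shows "\<Gamma> x u v = \<Gamma> x v u"
proof (rule inner_product_form_eqI[OF metric[OF assms]])
  show "h x (\<Gamma> x u v) w = h x (\<Gamma> x v u) w" for w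
    using koszul[OF assms, of u v w] koszul[OF assms, of v u w] dir_deriv_metric_commute[OF assms, of u v w]
    by linarith
qed

text \<open>Metric compatibility: in the sum of the Koszul formulas for \<open>(v, w)\<close> and
  \<open>(w, v)\<close> all but one derivative cancel.\<close>

lemma dir_deriv_metric:
  assumes "x \<in> S"
  shows "dir_deriv (\<lambda>y. h y v w) x u = h x (\<Gamma> x u v) w + h x v (\<Gamma> x u w)"
  using koszul[OF assms, of u v w] koszul[OF assms, of u w v] metric_commute[OF assms, of v "\<Gamma> x u w"]
    dir_deriv_metric_commute[OF assms, of w v u] by linarith

lemma christoffel_linear2: "x \<in> S \<Longrightarrow> linear (\<Gamma> x u)"
proof (rule linearI; rule inner_product_form_eqI[OF metric])
  assume x: "x \<in> S"
  fix v w z c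
  have "2 * h x (\<Gamma> x u (v + w)) z = 2 * h x (\<Gamma> x u v + \<Gamma> x u w) z"
    using x by (simp add: metric_simps distrib_left koszul dir_deriv_metric_simps)
  then show "h x (\<Gamma> x u (v + w)) z = h x (\<Gamma> x u v + \<Gamma> x u w) z" by simp
  have "2 * h x (\<Gamma> x u (c *\<^sub>R v)) z = c * (2 * h x (\<Gamma> x u v) z)"
    using x unfolding koszul[OF x] by (simp add: dir_deriv_metric_simps algebra_simps)
  then show "h x (\<Gamma> x u (c *\<^sub>R v)) z = h x (c *\<^sub>R \<Gamma> x u v) z" using x by (simp add: metric_simps)
qed

lemma christoffel_linear1:
  assumes "x \<in> S"
  shows "linear (\<lambda>u. \<Gamma> x u v)"
proof -
  have "(\<lambda>u. \<Gamma> x u v) = \<Gamma> x v" using christoffel_commute[OF assms] by blast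
  then show ?thesis using christoffel_linear2[OF assms] by simp
qed

lemmas christoffel_simps =
  linear_add[OF christoffel_linear1] linear_add[OF christoffel_linear2]
  linear_diff[OF christoffel_linear1] linear_diff[OF christoffel_linear2]
  linear_neg[OF christoffel_linear1] linear_neg[OF christoffel_linear2]
  linear_scale[OF christoffel_linear1] linear_scale[OF christoffel_linear2]

end

text \<open>
  Smoothness of the Christoffel symbols follows from that of the metric; assuming it here defers
  the inversion of the metric to the Hermitian case, where it is explicit
  (\<open>hermitian_chart\<close>).
\<close>

locale smooth_metric_chart = metric_chart +
  assumes smooth_christoffel: "smooth_on S (\<lambda>x. christoffel h x u v)"
begin

lemma differentiable_christoffel: "x \<in> S \<Longrightarrow> (\<lambda>x. \<Gamma> x u v) differentiable (at x)"
  using smooth_on_differentiable[OF smooth_christoffel] .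

lemma
  assumes x: "x \<in> S" and s: "s differentiable (at x)"
  shows differentiable_christoffel_field: "(\<lambda>y. \<Gamma> y v (s y)) differentiable (at x)"
    and dir_deriv_christoffel_field: "dir_deriv (\<lambda>y. \<Gamma> y v (s y)) x u =
      dir_deriv (\<lambda>y. \<Gamma> y v (s x)) x u + \<Gamma> x v (dir_deriv s x u)"
  using differentiable_field[OF open_S x christoffel_linear2 differentiable_christoffel[OF x] s]
    dir_deriv_field[OF open_S x christoffel_linear2 differentiable_christoffel[OF x] s] by blast+

lemma smooth_christoffel_field: "smooth_on S s \<Longrightarrow> smooth_on S (\<lambda>y. \<Gamma> y v (s y))"
  by (rule smooth_on_field[OF open_S christoffel_linear2 smooth_christoffel])

text \<open>Metric compatibility for varying fields: the derivative of the metric supplies the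
  Christoffel terms that complete the derivatives of \<open>s\<close> and \<open>t\<close> to
  covariant ones.\<close>

lemma
  assumes x: "x \<in> S" and s: "s differentiable (at x)" and t: "t differentiable (at x)"
  shows differentiable_metric_field: "(\<lambda>y. h y (s y) (t y)) differentiable (at x)"
    and dir_deriv_metric_field: "dir_deriv (\<lambda>y. h y (s y) (t y)) x u =
      h x (dir_deriv s x u + \<Gamma> x u (s x)) (t x) + h x (s x) (dir_deriv t x u + \<Gamma> x u (t x))"
proof -
  note 1 = differentiable_field[OF open_S x metric_linear(1) differentiable_metric[OF x] t]
    dir_deriv_field[OF open_S x metric_linear(1) differentiable_metric[OF x] t]
  show "(\<lambda>y. h y (s y) (t y)) differentiable (at x)"
    by (rule differentiable_field[OF open_S x metric_linear(2) 1(1) s])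
  have "dir_deriv (\<lambda>y. h y (s y) (t y)) x u =
      dir_deriv (\<lambda>y. h y (s x) (t y)) x u + h x (dir_deriv s x u) (t x)"
    by (rule dir_deriv_field[OF open_S x metric_linear(2) 1(1) s])
  also have "dir_deriv (\<lambda>y. h y (s x) (t y)) x u =
      dir_deriv (\<lambda>y. h y (s x) (t x)) x u + h x (s x) (dir_deriv t x u)"
    by (rule 1(2))
  finally show "dir_deriv (\<lambda>y. h y (s y) (t y)) x u =
      h x (dir_deriv s x u + \<Gamma> x u (s x)) (t x) + h x (s x) (dir_deriv t x u + \<Gamma> x u (t x))"
    using x by (simp add: metric_simps dir_deriv_metric)
qed

section \<open>Symmetries of the curvature tensor and of its covariant derivative\<close>

lemma smooth_riemann: "smooth_on S (\<lambda>x. riemann h x u v w)"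
  unfolding riemann_def
  by (intro smooth_on_add smooth_on_diff smooth_on_dir_deriv smooth_christoffel_field
      smooth_christoffel open_S)

lemma differentiable_riemann: "x \<in> S \<Longrightarrow> (\<lambda>x. riemann h x u v w) differentiable (at x)"
  using smooth_on_differentiable[OF smooth_riemann] .

lemma riemann_antisym: "riemann h x u v w = - riemann h x v u w"
  by (simp add: riemann_def)

lemma linear_dir_deriv_christoffel:
  assumes "x \<in> S"
  shows "linear (\<lambda>u. dir_deriv (\<lambda>y. \<Gamma> y u v) x w)" "linear (\<lambda>v. dir_deriv (\<lambda>y. \<Gamma> y u v) x w)"
    "linear (dir_deriv (\<lambda>y. \<Gamma> y u v) x)"
  using assms christoffel_linear1 christoffel_linear2 differentiable_christoffel
  by (auto intro!: linear_dir_deriv linear_dir_deriv_field[OF open_S])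

lemma riemann_linear:
  assumes x: "x \<in> S"
  shows "linear (\<lambda>u. riemann h x u v w)" "linear (\<lambda>v. riemann h x u v w)" "linear (riemann h x u v)"
proof -
  note lin = linear_dir_deriv_christoffel[OF x, THEN linear_add]
    linear_dir_deriv_christoffel[OF x, THEN linear_scale] christoffel_simps[OF x]
  show "linear (\<lambda>u. riemann h x u v w)" "linear (\<lambda>v. riemann h x u v w)" "linear (riemann h x u v)"
    by (auto intro!: linearI simp: riemann_def lin algebra_simps)
qed

text \<open>The mixed second derivatives of the function \<open>h y w z\<close> commute. Expanded by
  metric compatibility, their difference consists of the two curvature terms, the products of first
  covariant derivatives being symmetric in \<open>u\<close> and \<open>v\<close>.\<close>

lemma riemann_metric_antisym:
  assumes x: "x \<in> S"
  shows "h x (riemann h x u v w) z + h x w (riemann h x u v z) = 0"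
proof -
  have D2: "dir_deriv (\<lambda>y. dir_deriv (\<lambda>y. h y w z) y v) x u =
    h x (dir_deriv (\<lambda>y. \<Gamma> y v w) x u + \<Gamma> x u (\<Gamma> x v w)) z + h x (\<Gamma> x v w) (\<Gamma> x u z) +
    (h x (\<Gamma> x u w) (\<Gamma> x v z) + h x w (dir_deriv (\<lambda>y. \<Gamma> y v z) x u + \<Gamma> x u (\<Gamma> x v z)))" for u v
  proof -
    have "dir_deriv (\<lambda>y. dir_deriv (\<lambda>y. h y w z) y v) x u =
      dir_deriv (\<lambda>y. h y (\<Gamma> y v w) z + h y w (\<Gamma> y v z)) x u"
      by (intro dir_deriv_cong_open[OF open_S x] dir_deriv_metric
          smooth_on_differentiable[OF smooth_on_dir_deriv[OF smooth_metric] x])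
    then show ?thesis
      using x by (simp add: dir_deriv_add differentiable_metric_field dir_deriv_metric_field differentiable_christoffel)
  qed
  show ?thesis
    using D2[of v u] D2[of u v] dir_deriv_commute[OF open_S x smooth_metric, of w z u v]
    by (simp add: riemann_def metric_simps[OF x])
qed

lemma dir_deriv_riemann:
  assumes x: "x \<in> S"
  shows "dir_deriv (\<lambda>y. riemann h y b c d) x a =
    dir_deriv (\<lambda>y. dir_deriv (\<lambda>y. \<Gamma> y c d) y b) x a
    + dir_deriv (\<lambda>y. \<Gamma> y b (\<Gamma> x c d)) x a + \<Gamma> x b (dir_deriv (\<lambda>y. \<Gamma> y c d) x a)
    - dir_deriv (\<lambda>y. dir_deriv (\<lambda>y. \<Gamma> y b d) y c) x a
    - dir_deriv (\<lambda>y. \<Gamma> y c (\<Gamma> x b d)) x a - \<Gamma> x c (dir_deriv (\<lambda>y. \<Gamma> y b d) x a)"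
  unfolding riemann_def
  by (simp add: dir_deriv_add dir_deriv_diff
      differentiable_christoffel_field[OF x differentiable_christoffel[OF x]]
      dir_deriv_christoffel_field[OF x differentiable_christoffel[OF x]]
      smooth_on_differentiable[OF smooth_on_dir_deriv[OF smooth_christoffel] x])

lemma second_bianchi:
  assumes x: "x \<in> S"
  shows "cov_riemann h x a b c d + cov_riemann h x b c a d + cov_riemann h x c a b d = 0"
proof -
  \<comment> \<open>\<open>DR a b c\<close> is the commutator of \<open>\<nabla>\<^sub>a\<close>
    with the endomorphism \<open>R(b, c) = [\<nabla>\<^sub>b, \<nabla>\<^sub>c]\<close>, applied to
    \<open>d\<close>; its cyclic sum vanishes by the Jacobi identity. The corrections in the slots
    of \<open>b\<close> and \<open>c\<close> cancel because the connection is torsion-free.\<close>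
  define DR where "DR a b c = dir_deriv (\<lambda>y. riemann h y b c d) x a + \<Gamma> x a (riemann h x b c d)
     - riemann h x b c (\<Gamma> x a d)" for a b c
  have "DR a b c + DR b c a + DR c a b = 0"
    unfolding DR_def dir_deriv_riemann[OF x] unfolding riemann_def
    using dir_deriv_commute[OF open_S x smooth_christoffel]
    by (simp add: christoffel_simps[OF x] algebra_simps)
  moreover have eq: "cov_riemann h x a b c d = DR a b c - riemann h x (\<Gamma> x a b) c d + riemann h x (\<Gamma> x a c) b d" for a b c
    using riemann_antisym[of x b "\<Gamma> x a c" d] by (simp add: cov_riemann_def DR_def)
  ultimately show ?thesis
    unfolding eq christoffel_commute[OF x, of b a] christoffel_commute[OF x, of c b] christoffel_commute[OF x, of c a]
    by (simp add: algebra_simps)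
qed

lemma cov_riemann_antisym:
  assumes x: "x \<in> S"
  shows "cov_riemann h x a b c d = - cov_riemann h x a c b d"
proof -
  have "dir_deriv (\<lambda>y. riemann h y b c d) x a = - dir_deriv (\<lambda>y. riemann h y c b d) x a"
    by (simp add: dir_deriv_riemann[OF x])
  moreover have "\<Gamma> x a (riemann h x b c d) = - \<Gamma> x a (riemann h x c b d)"
    by (subst riemann_antisym) (simp add: christoffel_simps[OF x])
  ultimately show ?thesis
    using riemann_antisym[of x b c] riemann_antisym[of x "\<Gamma> x a b" c] riemann_antisym[of x b "\<Gamma> x a c"]
    by (simp add: cov_riemann_def)
qed

text \<open>Differentiate \<open>riemann_metric_antisym\<close>; the same identity at the
  Christoffel-corrected arguments removes the remaining terms.\<close>

lemma cov_riemann_metric_antisym: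
  assumes x: "x \<in> S"
  shows "h x (cov_riemann h x a b c d) e = - h x (cov_riemann h x a b c e) d"
proof -
  note D = dir_deriv_metric_field[OF x differentiable_riemann[OF x] differentiable_const]
    dir_deriv_metric_field[OF x differentiable_const differentiable_riemann[OF x]]
  have "dir_deriv (\<lambda>y. h y (riemann h y b c d) e + h y d (riemann h y b c e)) x a = dir_deriv (\<lambda>_. 0) x a"
    by (rule sym, rule dir_deriv_cong_open[OF open_S x]) (simp_all add: riemann_metric_antisym)
  then have "h x (dir_deriv (\<lambda>y. riemann h y b c d) x a + \<Gamma> x a (riemann h x b c d)) e
      + h x (riemann h x b c d) (\<Gamma> x a e)
      + (h x (\<Gamma> x a d) (riemann h x b c e)
      + h x d (dir_deriv (\<lambda>y. riemann h y b c e) x a + \<Gamma> x a (riemann h x b c e))) = 0"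
    using x by (simp add: dir_deriv_add differentiable_metric_field differentiable_riemann D)
  moreover note riemann_metric_antisym[OF x, of b c "\<Gamma> x a d" e] riemann_metric_antisym[OF x, of b c d "\<Gamma> x a e"]
    riemann_metric_antisym[OF x, of "\<Gamma> x a b" c d e] riemann_metric_antisym[OF x, of b "\<Gamma> x a c" d e]
  ultimately show ?thesis
    unfolding cov_riemann_def using metric_commute[OF x, of d]
    by (simp add: metric_simps[OF x])
qed

section \<open>The Ricci tensor and the contracted Bianchi identity\<close>

lemma differentiable_ricci: "x \<in> S \<Longrightarrow> (\<lambda>y. ricci h y u v) differentiable (at x)"
  unfolding ricci_def endo_trace_def
  by (intro differentiable_sum ballI differentiable_inner differentiable_riemann) auto

lemma ricci_linear:
  assumes "x \<in> S"
  shows "linear (ricci h x u)" "linear (\<lambda>u. ricci h x u v)"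
proof -
  note lin = riemann_linear(2,3)[OF assms, THEN linear_add] riemann_linear(2,3)[OF assms, THEN linear_scale]
  show "linear (ricci h x u)" "linear (\<lambda>u. ricci h x u v)"
    by (auto intro!: linearI simp: ricci_def endo_trace_def lin inner_add_left sum.distrib sum_distrib_left)
qed

lemmas ricci_simps =
  linear_add[OF ricci_linear(1)] linear_add[OF ricci_linear(2)]
  linear_diff[OF ricci_linear(1)] linear_diff[OF ricci_linear(2)]
  linear_neg[OF ricci_linear(1)] linear_neg[OF ricci_linear(2)]
  linear_scale[OF ricci_linear(1)] linear_scale[OF ricci_linear(2)]

lemma linear_cov_riemann:
  assumes x: "x \<in> S"
  shows "linear (\<lambda>b. cov_riemann h x a b c d)"
proof -
  have "linear (\<lambda>b. dir_deriv (\<lambda>y. riemann h y b c d) x a)"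
    using x by (intro linear_dir_deriv_field[OF open_S] riemann_linear differentiable_riemann)
  note lin = this[THEN linear_add] this[THEN linear_scale] riemann_linear[OF x, THEN linear_add]
    riemann_linear[OF x, THEN linear_scale] christoffel_simps[OF x]
  show ?thesis unfolding cov_riemann_def
    by (rule linearI) (simp_all add: lin algebra_simps)
qed

text \<open>Contraction commutes with covariant differentiation: the Christoffel terms of the traced
  argument and of the value cancel, as the trace of a product is independent of the order.\<close>

lemma cov_ricci_eq_trace:
  assumes x: "x \<in> S"
  shows "cov_deriv2 h (ricci h) x a c d = endo_trace (\<lambda>z. cov_riemann h x a z c d)"
proof -
  have "dir_deriv (\<lambda>y. ricci h y c d) x a = endo_trace (\<lambda>z. dir_deriv (\<lambda>y. riemann h y z c d) x a)"
    unfolding ricci_def endo_trace_def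
    using x bounded_linear.dir_deriv_image[OF bounded_linear_inner_left differentiable_riemann[OF x]]
    by (simp add: dir_deriv_sum differentiable_riemann)
  moreover have "endo_trace (\<lambda>z. \<Gamma> x a (riemann h x z c d)) = endo_trace (\<lambda>z. riemann h x (\<Gamma> x a z) c d)"
    using endo_trace_commute[OF christoffel_linear2[OF x] riemann_linear(1)[OF x]] .
  ultimately show ?thesis
    by (simp add: cov_deriv2_def ricci_def cov_riemann_def endo_trace_def inner_add_left inner_diff_left
        sum.distrib sum_subtractf)
qed

text \<open>Twice the divergence of Ric is the trace of \<nabla> Ric, obtained by contracting the
  second Bianchi identity twice.\<close>

lemma contracted_bianchi:
  assumes x: "x \<in> S" and E: "frame (h x) E"
  shows "2 * (\<Sum>e\<in>E. cov_deriv2 h (ricci h) x e c e) = (\<Sum>e\<in>E. cov_deriv2 h (ricci h) x c e e)"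
proof -
  define T where "T = cov_deriv2 h (ricci h) x"
  define R where "R a b c d e = h x (cov_riemann h x a b c d) e" for a b c d e
  have T: "T a c d = (\<Sum>e\<in>E. R a e c d e)" for a c d
    unfolding T_def R_def cov_ricci_eq_trace[OF x]
    by (rule endo_trace_frame[OF metric[OF x] E linear_cov_riemann[OF x]])
  have anti: "R a b c d e = - R a c b d e" "R a b c d e = - R a b c e d" for a b c d e
    using cov_riemann_antisym[OF x, of a b c d] cov_riemann_metric_antisym[OF x, of a b c d e]
    by (simp_all add: R_def metric_simps[OF x])
  have bianchi: "R a b c d e + R b c a d e + R c a b d e = 0" for a b c d e
    using arg_cong[OF second_bianchi[OF x, of a b c d], of "\<lambda>z. h x z e"] metric_simps(7)[OF x, of 0]
    by (simp add: R_def metric_simps[OF x] linear_0[OF metric_linear(2)[OF x]])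
  \<comment> \<open>The first contraction; the second one sets \<open>a = d\<close> and sums over
    the frame.\<close>
  have once: "T a c d + (\<Sum>e\<in>E. R e c a d e) - T c a d = 0" for a c d
  proof -
    have "R a e c d e + R e c a d e - R c e a d e = 0" for e
      using bianchi[of a e c d e] anti(1)[of c a e d e] by simp
    then have "(\<Sum>e\<in>E. R a e c d e + R e c a d e - R c e a d e) = 0" by simp
    then show ?thesis by (simp add: T sum.distrib sum_subtractf)
  qed
  have "(\<Sum>d\<in>E. T d c d) + (\<Sum>d\<in>E. \<Sum>e\<in>E. R e c d d e) - (\<Sum>d\<in>E. T c d d) = 0"
    using once by (simp flip: sum.distrib sum_subtractf)
  moreover have "(\<Sum>d\<in>E. \<Sum>e\<in>E. R e c d d e) = (\<Sum>e\<in>E. T e c e)"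
  proof -
    have "R e c d d e = R e d c e d" for d e
      using anti(1)[of e c d d e] anti(2)[of e d c d e] by simp
    then show ?thesis by (subst sum.swap) (simp add: T)
  qed
  ultimately show ?thesis by (simp add: T_def)
qed

end

section \<open>Gradient solitons\<close>

locale soliton_chart = smooth_metric_chart S h
  for S :: "'e::euclidean_space set" and h +
  fixes F :: "'e \<Rightarrow> real" and l :: real
  assumes smooth_potential: "smooth_on S F"
    and soliton: "x \<in> S \<Longrightarrow> ricci h x u v + hessian h F x u v = l * h x u v"
begin

abbreviation "T \<equiv> cov_deriv2 h (ricci h)"
abbreviation "G \<equiv> gradient h F"

lemma differentiable_potential: "x \<in> S \<Longrightarrow> F differentiable (at x)"
  using smooth_on_differentiable[OF smooth_potential] .

lemma differentiable_dir_deriv_potential: "x \<in> S \<Longrightarrow> (\<lambda>y. dir_deriv F y v) differentiable (at x)"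
  using smooth_on_differentiable[OF smooth_on_dir_deriv[OF smooth_potential]] .

lemma metric_gradient: "x \<in> S \<Longrightarrow> h x (G x) v = dir_deriv F x v"
  unfolding gradient_def
  by (rule sharp_works[of h x, OF metric linear_dir_deriv[OF differentiable_potential]])

text \<open>Read off from the soliton equation, whose Hessian and metric terms are
  symmetric.\<close>

lemma ricci_commute:
  assumes x: "x \<in> S"
  shows "ricci h x u v = ricci h x v u"
proof -
  have "hessian h F x u v = hessian h F x v u"
    unfolding hessian_def dir_deriv_commute[OF open_S x smooth_potential, of v u]
      christoffel_commute[OF x, of u v] ..
  then show ?thesis
    using soliton[OF x, of u v] soliton[OF x, of v u] metric_commute[OF x, of u v]
    by (metis add_right_cancel)
qed

lemma cov_ricci_commute:
  assumes x: "x \<in> S"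
  shows "T x a u v = T x a v u"
proof -
  have "dir_deriv (\<lambda>y. ricci h y u v) x a = dir_deriv (\<lambda>y. ricci h y v u) x a"
    by (intro dir_deriv_cong_open[OF open_S x] ricci_commute differentiable_ricci x)
  then show ?thesis
    using ricci_commute[OF x, of "\<Gamma> x a u" v] ricci_commute[OF x, of u "\<Gamma> x a v"]
    by (simp add: cov_deriv2_def)
qed

lemma dir_deriv_hessian:
  assumes x: "x \<in> S"
  shows "dir_deriv (\<lambda>y. hessian h F y v w) x u =
    dir_deriv (\<lambda>y. dir_deriv (\<lambda>y. dir_deriv F y w) y v) x u
    - dir_deriv (\<lambda>y. dir_deriv F y (\<Gamma> x v w)) x u - dir_deriv F x (dir_deriv (\<lambda>y. \<Gamma> y v w) x u)"
proof -
  note lin = linear_dir_deriv[OF differentiable_potential]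
  note 1 = differentiable_field[OF open_S x lin differentiable_dir_deriv_potential[OF x] differentiable_christoffel[OF x]]
    dir_deriv_field[OF open_S x lin differentiable_dir_deriv_potential[OF x] differentiable_christoffel[OF x]]
  show ?thesis unfolding hessian_def
    using x by (simp add: dir_deriv_diff 1
       smooth_on_differentiable[OF smooth_on_dir_deriv[OF smooth_on_dir_deriv[OF smooth_potential]]])
qed

text \<open>The Ricci identity for the 1-form \<open>dF\<close>: third derivatives commute, and what
  remains of the Christoffel terms is the curvature.\<close>

lemma cov_hessian_commutator:
  assumes x: "x \<in> S"
  shows "cov_deriv2 h (hessian h F) x u v w - cov_deriv2 h (hessian h F) x v u w =
    - dir_deriv F x (riemann h x u v w)"
proof -
  note lin = linear_dir_deriv[OF differentiable_potential[OF x]]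
  have "dir_deriv (\<lambda>y. dir_deriv (\<lambda>y. dir_deriv F y w) y v) x u =
      dir_deriv (\<lambda>y. dir_deriv (\<lambda>y. dir_deriv F y w) y u) x v"
    by (rule dir_deriv_commute[OF open_S x smooth_on_dir_deriv[OF smooth_potential]])
  then show ?thesis
    using dir_deriv_commute[OF open_S x smooth_potential] christoffel_commute[OF x, of u v]
    unfolding cov_deriv2_def dir_deriv_hessian[OF x] unfolding hessian_def riemann_def
    by (simp add: linear_add[OF lin] linear_diff[OF lin])
qed

text \<open>The metric is parallel, so the soliton equation gives \<nabla> Ric as minus the
  covariant derivative of the Hessian, whose commutator is known.\<close>

lemma cov_ricci_commutator:
  assumes x: "x \<in> S"
  shows "T x u v w - T x v u w = h x (G x) (riemann h x u v w)"
proof -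
  have "T x u v w = - cov_deriv2 h (hessian h F) x u v w" for u v w
  proof -
    have "dir_deriv (\<lambda>y. ricci h y v w + hessian h F y v w) x u = dir_deriv (\<lambda>y. l * h y v w) x u"
      by (rule sym, rule dir_deriv_cong_open[OF open_S x])
        (use x soliton in \<open>auto intro!: differentiable_mult differentiable_metric\<close>)
    moreover have "(\<lambda>y. hessian h F y v w) differentiable (at x)"
      using differentiable_cong_open[OF open_S x, of "\<lambda>y. l * h y v w - ricci h y v w" "\<lambda>y. hessian h F y v w"]
        soliton differentiable_metric[OF x] differentiable_ricci[OF x]
      by (simp add: algebra_simps)
    moreover have "dir_deriv (\<lambda>y. l * h y v w) x u = l * (h x (\<Gamma> x u v) w + h x v (\<Gamma> x u w))"
      using bounded_linear.dir_deriv_image[OF bounded_linear_mult_right differentiable_metric[OF x]]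
      by (simp add: dir_deriv_metric[OF x])
    ultimately have "dir_deriv (\<lambda>y. ricci h y v w) x u + dir_deriv (\<lambda>y. hessian h F y v w) x u =
        l * (h x (\<Gamma> x u v) w + h x v (\<Gamma> x u w))"
      using differentiable_ricci[OF x] by (simp add: dir_deriv_add)
    then show ?thesis
      using soliton[OF x, of "\<Gamma> x u v" w] soliton[OF x, of v "\<Gamma> x u w"]
      by (simp add: cov_deriv2_def algebra_simps)
  qed
  then show ?thesis using cov_hessian_commutator[OF x, of u v w] metric_gradient[OF x] by simp
qed

text \<open>The commutator is \<open>h x (G x) (riemann h x u v (G x))\<close>, which vanishes
  because \<open>riemann h x u v\<close> is skew.\<close>

lemma cov_ricci_gradient_commute:
  assumes x: "x \<in> S"
  shows "T x u v (G x) = T x v u (G x)"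
  using cov_ricci_commutator[OF x, of u v "G x"] riemann_metric_antisym[OF x, of u v "G x" "G x"]
    metric_commute[OF x, of "G x" "riemann h x u v (G x)"] by linarith

text \<open>Tracing the commutator gives div Ric as the trace of \<nabla> Ric minus
  \<open>Ric(v, G)\<close>. By the contracted Bianchi identity that trace is 2 div Ric.\<close>

lemma divergence_ricci:
  assumes x: "x \<in> S" and E: "frame (h x) E"
  shows "(\<Sum>e\<in>E. T x e v e) = ricci h x v (G x)"
proof -
  have "T x e v e = T x v e e - h x (riemann h x e v (G x)) e" for e
    using cov_ricci_commutator[OF x, of e v e] riemann_metric_antisym[OF x, of e v "G x" e] by simp
  then have "(\<Sum>e\<in>E. T x e v e) = (\<Sum>e\<in>E. T x v e e) - (\<Sum>e\<in>E. h x (riemann h x e v (G x)) e)"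
    by (simp add: sum_subtractf)
  also have "(\<Sum>e\<in>E. h x (riemann h x e v (G x)) e) = ricci h x v (G x)"
    unfolding ricci_def by (rule endo_trace_frame[OF metric[OF x] E riemann_linear(1)[OF x], symmetric])
  finally show ?thesis using contracted_bianchi[OF x E, of v] by simp
qed

end


section \<open>Unitary frames\<close>

lemma J_linear: "linear J"
  by (rule linearI) (simp_all add: J_def vec_eq_iff algebra_simps)

lemmas J_simps = linear_add[OF J_linear] linear_diff[OF J_linear] linear_neg[OF J_linear]
  linear_scale[OF J_linear] linear_0[OF J_linear]

lemma
  fixes \<beta> :: "'a \<Rightarrow> 'a \<Rightarrow> 'a \<Rightarrow> real"
  assumes alt: "\<And>u v w. \<beta> u v w = - \<beta> v u w" "\<And>u v w. \<beta> u v w = - \<beta> u w v"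
  shows alternating3_zero: "\<beta> u u w = 0" "\<beta> u w w = 0" "\<beta> u w u = 0"
    and alternating3_perm: "\<beta> v u w = - \<beta> u v w" "\<beta> u w v = - \<beta> u v w"
      "\<beta> w v u = - \<beta> u v w" "\<beta> v w u = \<beta> u v w" "\<beta> w u v = \<beta> u v w"
proof -
  note a = alt(1)[of u u w] alt(2)[of u w w] alt(1)[of u w u] alt(2)[of w u u]
    alt(1)[of v u w] alt(2)[of u w v] alt(1)[of w v u] alt(2)[of v w u] alt(1)[of w u v]
  show "\<beta> u u w = 0" "\<beta> u w w = 0" "\<beta> u w u = 0"
    "\<beta> v u w = - \<beta> u v w" "\<beta> u w v = - \<beta> u v w"
    "\<beta> w v u = - \<beta> u v w" "\<beta> v w u = \<beta> u v w" "\<beta> w u v = \<beta> u v w"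
    using a by linarith+
qed

locale hermitian_inner =
  fixes q :: "complex^2 \<Rightarrow> complex^2 \<Rightarrow> real"
  assumes inner_form: "inner_product_form q"
    and J_inv: "q (J u) (J v) = q u v"
begin

lemmas q_linear = inner_product_form_linear[OF inner_form]

lemmas q_simps =
  linear_add[OF q_linear(1)] linear_add[OF q_linear(2)]
  linear_diff[OF q_linear(1)] linear_diff[OF q_linear(2)]
  linear_neg[OF q_linear(1)] linear_neg[OF q_linear(2)]
  linear_scale[OF q_linear(1)] linear_scale[OF q_linear(2)]
  linear_0[OF q_linear(1)] linear_0[OF q_linear(2)]

lemma q_commute: "q u v = q v u"
  using inner_form by (simp add: inner_product_form_def)

lemma q_pos: "u \<noteq> 0 \<Longrightarrow> q u u > 0"
  using inner_form by (simp add: inner_product_form_def)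

lemma q_J_left: "q (J u) v = - q u (J v)"
  using J_inv[of u "J v"] by (simp add: J_J q_simps)

lemma q_J_skew: "q u (J v) = - q v (J u)"
  using q_J_left[of u v] q_commute[of v] by simp

lemma q_J_self: "q u (J u) = 0"
  using q_J_left[of u u] q_commute[of u "J u"] by simp

text \<open>The map \<phi> collects the Hermitian products with \<open>e1\<close> and
  \<open>e2\<close>. It is onto by an explicit preimage, hence injective by dimension, and it takes
  the same value on both sides.\<close>

lemma unitary_expansion:
  assumes nz: "e1 \<noteq> 0" "e2 \<noteq> 0" and orth: "q e1 e2 = 0" "q e1 (J e2) = 0"
  shows "v = (q v e1 / q e1 e1) *\<^sub>R e1 + (q v (J e1) / q e1 e1) *\<^sub>R J e1 +
    (q v e2 / q e2 e2) *\<^sub>R e2 + (q v (J e2) / q e2 e2) *\<^sub>R J e2"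
proof -
  have "q e2 (J e1) = 0" using orth(2) q_J_skew[of e2 e1] by simp
  note orth' = orth this orth[unfolded q_commute[of e1]] q_J_self J_inv q_J_left
  have pos: "q e1 e1 \<noteq> 0" "q e2 e2 \<noteq> 0" using q_pos nz by (simp_all add: less_imp_neq[symmetric])
  define \<phi> :: "complex^2 \<Rightarrow> complex^2" where
    "\<phi> w = (\<chi> i. if i = 1 then Complex (q w e1) (q w (J e1)) else Complex (q w e2) (q w (J e2)))" for w
  have lin: "linear \<phi>"
    by (rule linearI) (simp_all add: \<phi>_def vec_eq_iff q_simps complex_eq_iff)
  have "\<exists>w. \<phi> w = z" for z
  proof
    show "\<phi> ((Re (z $ 1) / q e1 e1) *\<^sub>R e1 + (Im (z $ 1) / q e1 e1) *\<^sub>R J e1 +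
      (Re (z $ 2) / q e2 e2) *\<^sub>R e2 + (Im (z $ 2) / q e2 e2) *\<^sub>R J e2) = z"
      using pos by (simp add: \<phi>_def vec_eq_iff forall_2 q_simps complex_eq_iff orth' J_J)
  qed
  then have "surj \<phi>" by (metis surjI)
  then have "inj \<phi>" using linear_surjective_imp_injective[OF lin] by simp
  moreover have "\<phi> v = \<phi> ((q v e1 / q e1 e1) *\<^sub>R e1 + (q v (J e1) / q e1 e1) *\<^sub>R J e1 +
    (q v e2 / q e2 e2) *\<^sub>R e2 + (q v (J e2) / q e2 e2) *\<^sub>R J e2)"
    using pos by (simp add: \<phi>_def vec_eq_iff forall_2 q_simps complex_eq_iff orth' J_J)
  ultimately show ?thesis by (rule injD)
qed

end

text \<open>Gram-Schmidt over the complex numbers, applied to the standard basis of \<open>complex^2\<close>.\<close>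

definition basis_fst :: "complex^2" where
  "basis_fst = axis 1 1"

definition basis_snd_orth :: "(complex^2 \<Rightarrow> complex^2 \<Rightarrow> real) \<Rightarrow> complex^2" where
  "basis_snd_orth q = axis 2 1 - (q (axis 2 1) basis_fst / q basis_fst basis_fst) *\<^sub>R basis_fst
     - (q (axis 2 1) (J basis_fst) / q basis_fst basis_fst) *\<^sub>R J basis_fst"

lemma basis_fst_nonzero: "basis_fst \<noteq> 0"
  by (simp add: basis_fst_def axis_eq_0_iff)

text \<open>Its second coordinate is 1, since only complex multiples of the first basis vector are
  subtracted.\<close>

lemma basis_snd_orth_nonzero: "basis_snd_orth q \<noteq> 0"
proof
  assume "basis_snd_orth q = 0"
  then have "basis_snd_orth q $ 2 = 0" by simp
  then show False by (simp add: basis_snd_orth_def basis_fst_def J_def axis_def)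
qed

context hermitian_inner
begin

lemma basis_orth:
  "q basis_fst (basis_snd_orth q) = 0" "q basis_fst (J (basis_snd_orth q)) = 0"
  using q_pos[OF basis_fst_nonzero] q_commute[of basis_fst "axis 2 1"] q_J_skew[of basis_fst "axis 2 1"]
  unfolding basis_snd_orth_def
  by (simp_all add: q_simps J_simps J_J q_J_self q_J_left)

text \<open>Normalisation of the orthogonal pair; this frame serves at a single point, so its
  dependence on the point is immaterial.\<close>

lemma unitary_frame:
  obtains e1 e2 where "q e1 e1 = 1" "q e2 e2 = 1" "q e1 e2 = 0" "q e1 (J e2) = 0"
proof
  let ?n = "\<lambda>v. (1 / sqrt (q v v)) *\<^sub>R v"
  have "q (?n v) (?n v) = 1" if "v \<noteq> 0" for v
    using q_pos[OF that] by (simp add: q_simps real_sqrt_mult_self)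
  then show "q (?n basis_fst) (?n basis_fst) = 1"
    "q (?n (basis_snd_orth q)) (?n (basis_snd_orth q)) = 1"
    using basis_fst_nonzero basis_snd_orth_nonzero by blast+
  show "q (?n basis_fst) (?n (basis_snd_orth q)) = 0" "q (?n basis_fst) (J (?n (basis_snd_orth q))) = 0"
    by (simp_all only: J_simps q_simps basis_orth) simp_all
qed

end

text \<open>Together with \<open>J\<close>-invariance these conditions make \<open>e1\<close>,
  \<open>J e1\<close>, \<open>e2\<close>, \<open>J e2\<close> a real orthonormal basis.\<close>

locale unitary_basis = hermitian_inner +
  fixes e1 e2 :: "complex^2"
  assumes unit: "q e1 e1 = 1" "q e2 e2 = 1" and orth: "q e1 e2 = 0" "q e1 (J e2) = 0"
begin

lemma expansion: "v = q v e1 *\<^sub>R e1 + q v (J e1) *\<^sub>R J e1 + q v e2 *\<^sub>R e2 + q v (J e2) *\<^sub>R J e2"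
proof -
  have "e1 \<noteq> 0" "e2 \<noteq> 0" using unit q_simps(9) by force+
  from unitary_expansion[OF this orth, of v] show ?thesis by (simp add: unit)
qed

text \<open>The frame is a set, so its four elements must be shown distinct before the sum
  splits.\<close>

lemma sum_unitary_basis:
  "(\<Sum>e\<in>{e1, J e1, e2, J e2}. \<phi> e) = \<phi> e1 + \<phi> (J e1) + \<phi> e2 + \<phi> (J e2)" for \<phi> :: "complex^2 \<Rightarrow> 'b::real_vector"
proof -
  have "q e2 (J e1) = 0" using orth(2) q_J_skew[of e2 e1] by simp
  then have "e1 \<noteq> J e1" "e1 \<noteq> e2" "e1 \<noteq> J e2" "e2 \<noteq> J e1" "J e1 \<noteq> J e2" "e2 \<noteq> J e2"
    using unit orth q_J_self[of e1] q_J_self[of e2] J_inv[of e1 e2] J_inv[of e1 e1] by force+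
  then show ?thesis by (simp add: add.assoc)
qed

lemma frame: "frame q {e1, J e1, e2, J e2}"
  unfolding frame_def sum_unitary_basis using expansion by simp

lemma linear_eq_0:
  assumes L: "linear (L :: complex^2 \<Rightarrow> real)"
    and E: "\<And>e. e \<in> {e1, J e1, e2, J e2} \<Longrightarrow> L e = 0"
  shows "L v = 0"
  by (subst expansion) (simp add: linear_add[OF L] linear_scale[OF L] E)

text \<open>A 4-form in real dimension 4 is determined by its value on one basis, and
  \<open>key\<close> is that value. Multilinearity replaces the arguments by basis vectors one slot
  at a time.\<close>

lemma wedge_eq_0:
  assumes \<alpha>: "linear \<alpha>"
    and \<beta>: "\<And>v w. linear (\<lambda>u. \<beta> u v w)" "\<And>u w. linear (\<lambda>v. \<beta> u v w)" "\<And>u v. linear (\<beta> u v)"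
    and alt: "\<And>u v w. \<beta> u v w = - \<beta> v u w" "\<And>u v w. \<beta> u v w = - \<beta> u w v"
    and key: "\<alpha> e1 * \<beta> (J e1) e2 (J e2) - \<alpha> (J e1) * \<beta> e1 e2 (J e2)
      + \<alpha> e2 * \<beta> e1 (J e1) (J e2) - \<alpha> (J e2) * \<beta> e1 (J e1) e2 = 0"
  shows "wedge_1_3 \<alpha> \<beta> u1 u2 u3 u4 = 0"
proof -
  let ?E = "{e1, J e1, e2, J e2}"
  note lin = linear_add[OF \<alpha>] linear_scale[OF \<alpha>] \<beta>[THEN linear_add] \<beta>[THEN linear_scale]
  have W: "linear (\<lambda>u1. wedge_1_3 \<alpha> \<beta> u1 u2 u3 u4)" "linear (\<lambda>u2. wedge_1_3 \<alpha> \<beta> u1 u2 u3 u4)"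
    "linear (\<lambda>u3. wedge_1_3 \<alpha> \<beta> u1 u2 u3 u4)" "linear (wedge_1_3 \<alpha> \<beta> u1 u2 u3)" for u1 u2 u3 u4
    by (auto intro!: linearI simp: wedge_1_3_def lin algebra_simps)
  note zero = alternating3_zero[of \<beta>, OF alt] and perm = alternating3_perm[of \<beta>, OF alt]
  have 4: "wedge_1_3 \<alpha> \<beta> a b c d = 0" if "a \<in> ?E" "b \<in> ?E" "c \<in> ?E" "d \<in> ?E" for a b c d
    \<comment> \<open>Up to order there are four triples of basis vectors; instantiating
      \<open>perm\<close> at these gives each a unique normal form and keeps rewriting from
      looping.\<close>
    using that key unfolding wedge_1_3_def
    by (auto simp: zero perm[where u=e1 and v="J e1" and w=e2] perm[where u=e1 and v="J e1" and w="J e2"]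
        perm[where u=e1 and v=e2 and w="J e2"] perm[where u="J e1" and v=e2 and w="J e2"])
  have 3: "wedge_1_3 \<alpha> \<beta> a b c u4 = 0" if "a \<in> ?E" "b \<in> ?E" "c \<in> ?E" for a b c
    by (rule linear_eq_0[OF W(4) 4[OF that]])
  have 2: "wedge_1_3 \<alpha> \<beta> a b u3 u4 = 0" if "a \<in> ?E" "b \<in> ?E" for a b
    by (rule linear_eq_0[OF W(3) 3[OF that]])
  have 1: "wedge_1_3 \<alpha> \<beta> a u2 u3 u4 = 0" if "a \<in> ?E" for a
    by (rule linear_eq_0[OF W(2) 2[OF that]])
  show ?thesis by (rule linear_eq_0[OF W(1) 1])
qed

text \<open>The pointwise algebra of the theorem, with \<rho>, \<open>N\<close>, \<beta> in the
  roles of Ric, \<nabla>J and d\<omega>. In a unitary basis, \<open>sum\<close> is exactly twice the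
  component required by \<open>wedge_eq_0\<close>.\<close>

lemma wedge_tracefree_eq_0:
  assumes \<rho>: "\<And>u. linear (\<rho> u)" "\<And>v. linear (\<lambda>u. \<rho> u v)" "\<And>u v. \<rho> u v = \<rho> v u"
      "\<And>u v. \<rho> (J u) (J v) = \<rho> u v"
    and \<beta>: "\<And>v w. linear (\<lambda>u. \<beta> u v w)" "\<And>u w. linear (\<lambda>v. \<beta> u v w)" "\<And>u v. linear (\<beta> u v)"
    and alt: "\<And>u v w. \<beta> u v w = - \<beta> v u w" "\<And>u v w. \<beta> u v w = - \<beta> u w v"
    and N: "\<And>u v w. 2 * q (N u v) w = \<beta> u (J v) (J w) - \<beta> u v w"
    and sum: "(\<Sum>e\<in>{e1, J e1, e2, J e2}. \<rho> (N e e) G + \<rho> e (N e G)) = 0"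
  shows "wedge_1_3 (\<lambda>w. \<rho> G w - (\<Sum>e\<in>{e1, J e1, e2, J e2}. \<rho> e e) / 4 * q G w) \<beta> u1 u2 u3 u4 = 0"
proof (rule wedge_eq_0[OF _ \<beta> alt])
  show "linear (\<lambda>w. \<rho> G w - (\<Sum>e\<in>{e1, J e1, e2, J e2}. \<rho> e e) / 4 * q G w)"
    by (rule linearI) (simp_all add: linear_add[OF \<rho>(1)] linear_scale[OF \<rho>(1)] q_simps algebra_simps)
  note lin = \<rho>(1,2)[THEN linear_add] \<rho>(1,2)[THEN linear_scale] \<rho>(1,2)[THEN linear_neg]
    \<beta>[THEN linear_add] \<beta>[THEN linear_scale] \<beta>[THEN linear_diff] \<beta>[THEN linear_neg]
  note zero = alternating3_zero[of \<beta>, OF alt] and perm = alternating3_perm[of \<beta>, OF alt]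
  define g1 g2 g3 g4 where g: "g1 = q G e1" "g2 = q G (J e1)" "g3 = q G e2" "g4 = q G (J e2)"
  \<comment> \<open>Symmetry and \<open>J\<close>-invariance leave \<rho> these four real
    components, those of a Hermitian 2 by 2 matrix.\<close>
  define p r s t where prst: "p = \<rho> e1 e1" "r = \<rho> e2 e2" "s = \<rho> e1 e2" "t = \<rho> e1 (J e2)"
  have G: "G = g1 *\<^sub>R e1 + g2 *\<^sub>R J e1 + g3 *\<^sub>R e2 + g4 *\<^sub>R J e2"
    unfolding g by (rule expansion)
  have JG: "J G = g1 *\<^sub>R J e1 - g2 *\<^sub>R e1 + g3 *\<^sub>R J e2 - g4 *\<^sub>R e2"
    by (subst G) (simp add: J_simps J_J)
  have \<rho>J: "\<rho> (J u) v = - \<rho> u (J v)" for u v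
    using \<rho>(4)[of u "J v"] by (simp add: J_J lin)
  have self: "\<rho> u (J u) = 0" for u
    using \<rho>J[of u u] \<rho>(3)[of u "J u"] by simp
  have "\<rho> e2 e1 = s" "\<rho> e2 (J e1) = - t"
    using \<rho>(3)[of e2 e1] \<rho>J[of e1 e2] \<rho>(3)[of "J e1" e2] by (simp_all add: prst)
  then have table: "\<rho> e1 e1 = p" "\<rho> (J e1) (J e1) = p" "\<rho> e1 (J e1) = 0" "\<rho> (J e1) e1 = 0"
    "\<rho> e2 e2 = r" "\<rho> (J e2) (J e2) = r" "\<rho> e2 (J e2) = 0" "\<rho> (J e2) e2 = 0"
    "\<rho> e1 e2 = s" "\<rho> e2 e1 = s" "\<rho> (J e1) (J e2) = s" "\<rho> (J e2) (J e1) = s"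
    "\<rho> e1 (J e2) = t" "\<rho> (J e2) e1 = t" "\<rho> (J e1) e2 = - t" "\<rho> e2 (J e1) = - t"
    using self \<rho>(4) \<rho>(3)[of "J e2" e1] \<rho>J[of e1] \<rho>J[of e2 e2] by (simp_all add: prst)
  have \<rho>N: "\<rho> (N u v) w = q (N u v) e1 * \<rho> e1 w + q (N u v) (J e1) * \<rho> (J e1) w
      + q (N u v) e2 * \<rho> e2 w + q (N u v) (J e2) * \<rho> (J e2) w" for u v w
    by (subst expansion[of "N u v"]) (simp add: lin)
  have N': "q (N u v) w = (\<beta> u (J v) (J w) - \<beta> u v w) / 2" for u v w
    using N[of u v w] by simp
  note perms = perm[where u=e1 and v="J e1" and w=e2] perm[where u=e1 and v="J e1" and w="J e2"] perm[where u=e1 and v=e2 and w="J e2"] perm[where u="J e1" and v=e2 and w="J e2"]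
  \<comment> \<open>The four components of an alternating 3-form in dimension 4.\<close>
  define b1 b2 b3 b4 where b: "b1 = \<beta> (J e1) e2 (J e2)" "b2 = \<beta> e1 e2 (J e2)"
    "b3 = \<beta> e1 (J e1) (J e2)" "b4 = \<beta> e1 (J e1) e2"
  have \<rho>G: "\<rho> e1 G = g1 * p + g3 * s + g4 * t" "\<rho> (J e1) G = g2 * p - g3 * t + g4 * s"
    "\<rho> e2 G = g1 * s - g2 * t + g3 * r" "\<rho> (J e2) G = g1 * t + g2 * s + g4 * r"
    by (subst G, simp add: lin table)+
  \<comment> \<open>The right-hand side is \<rho>(G, Z) for
    \<open>Z = b1 e1 - b2 J e1 + b3 e2 - b4 J e2\<close>; the wedge component sought is the
    trace-free part of \<rho> on the same pair.\<close>
  have 1: "\<rho> (N e1 e1) G + \<rho> (N (J e1) (J e1)) G + \<rho> (N e2 e2) G + \<rho> (N (J e2) (J e2)) G =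
      b3 * \<rho> e2 G - b4 * \<rho> (J e2) G + b1 * \<rho> e1 G - b2 * \<rho> (J e1) G"
    unfolding \<rho>N N' J_J by (simp add: lin zero perms flip: b)
  have 2: "\<rho> e (N e G) = q (N e G) e1 * \<rho> e1 e + q (N e G) (J e1) * \<rho> (J e1) e
      + q (N e G) e2 * \<rho> e2 e + q (N e G) (J e2) * \<rho> (J e2) e" for e
    using \<rho>N[of e G e] \<rho>(3)[of e] by simp
  \<comment> \<open>In terms of the same \<open>Z\<close> this is \<rho>(G, Z) minus half the trace
    of \<rho> times \<open>q G Z\<close>.\<close>
  have 3: "\<rho> e1 (N e1 G) + \<rho> (J e1) (N (J e1) G) + \<rho> e2 (N e2 G) + \<rho> (J e2) (N (J e2) G) =
      s * (g3 * b1 - g4 * b2 + g1 * b3 - g2 * b4) + p * (g4 * b4 - g3 * b3) + r * (g2 * b2 - g1 * b1)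
      + t * (g4 * b1 + g3 * b2 - g1 * b4 - g2 * b3)"
    unfolding 2 N' JG J_J unfolding G table by (simp add: lin zero perms field_simps flip: b)
  have "b3 * \<rho> e2 G - b4 * \<rho> (J e2) G + b1 * \<rho> e1 G - b2 * \<rho> (J e1) G +
      (s * (g3 * b1 - g4 * b2 + g1 * b3 - g2 * b4) + p * (g4 * b4 - g3 * b3) + r * (g2 * b2 - g1 * b1)
      + t * (g4 * b1 + g3 * b2 - g1 * b4 - g2 * b3)) = 0"
    using sum 1 3 unfolding sum_unitary_basis by linarith
  \<comment> \<open>The trace of \<rho> is \<open>2 * (p + r)\<close>, so the sum of the two halves
    is twice the trace-free part evaluated on \<open>G\<close> and \<open>Z\<close>.\<close>
  then
  show "(\<rho> G e1 - (\<Sum>e\<in>{e1, J e1, e2, J e2}. \<rho> e e) / 4 * q G e1) * \<beta> (J e1) e2 (J e2) -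
    (\<rho> G (J e1) - (\<Sum>e\<in>{e1, J e1, e2, J e2}. \<rho> e e) / 4 * q G (J e1)) * \<beta> e1 e2 (J e2) +
    (\<rho> G e2 - (\<Sum>e\<in>{e1, J e1, e2, J e2}. \<rho> e e) / 4 * q G e2) * \<beta> e1 (J e1) (J e2) -
    (\<rho> G (J e2) - (\<Sum>e\<in>{e1, J e1, e2, J e2}. \<rho> e e) / 4 * q G (J e2)) * \<beta> e1 (J e1) e2 = 0"
    unfolding sum_unitary_basis \<rho>(3)[of G] \<rho>G table g[symmetric] b[symmetric]
    by (simp add: field_simps)
qed

end

section \<open>Hermitian metrics on holomorphic charts\<close>

locale hermitian_chart = metric_chart S h for S :: "(complex^2) set" and h +
  assumes metric_J: "x \<in> S \<Longrightarrow> h x (J u) (J v) = h x u v"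
begin

section \<open>Smooth raising of indices by a Hermitian metric\<close>

lemma hermitian_inner: "x \<in> S \<Longrightarrow> hermitian_inner (h x)"
  by (rule hermitian_inner.intro) (auto intro: metric metric_J)

text \<open>The unnormalised Gram-Schmidt basis inverts the metric by a formula rational in its
  components, from which smoothness is visible without square roots.\<close>

lemma sharp_eq:
  assumes x: "x \<in> S" and \<alpha>: "linear \<alpha>"
  defines "e1 \<equiv> basis_fst" and "e2 \<equiv> basis_snd_orth (h x)"
  shows "sharp h x \<alpha> = (\<alpha> e1 / h x e1 e1) *\<^sub>R e1 + (\<alpha> (J e1) / h x e1 e1) *\<^sub>R J e1 +
    (\<alpha> e2 / h x e2 e2) *\<^sub>R e2 + (\<alpha> (J e2) / h x e2 e2) *\<^sub>R J e2"
proof (rule inner_product_form_eqI[OF metric[OF x]])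
  interpret hermitian_inner "h x" by (rule hermitian_inner[OF x])
  fix w
  have "\<alpha> w = \<alpha> ((h x w e1 / h x e1 e1) *\<^sub>R e1 + (h x w (J e1) / h x e1 e1) *\<^sub>R J e1 +
    (h x w e2 / h x e2 e2) *\<^sub>R e2 + (h x w (J e2) / h x e2 e2) *\<^sub>R J e2)"
    unfolding e1_def e2_def
    by (rule arg_cong[OF unitary_expansion[OF basis_fst_nonzero basis_snd_orth_nonzero basis_orth]])
  then show "h x (sharp h x \<alpha>) w = h x ((\<alpha> e1 / h x e1 e1) *\<^sub>R e1 + (\<alpha> (J e1) / h x e1 e1) *\<^sub>R J e1 +
    (\<alpha> e2 / h x e2 e2) *\<^sub>R e2 + (\<alpha> (J e2) / h x e2 e2) *\<^sub>R J e2) w"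
    unfolding sharp_works[of h x, OF metric[OF x] \<alpha>]
    by (simp add: linear_add[OF \<alpha>] linear_scale[OF \<alpha>] q_simps q_commute[of w] mult.commute)
qed

lemma smooth_metric_field:
  assumes "smooth_on S s" "smooth_on S t"
  shows "smooth_on S (\<lambda>x. h x (s x) (t x))"
  by (rule smooth_on_field[OF open_S metric_linear(2) smooth_on_field[OF open_S metric_linear(1) smooth_metric assms(2)] assms(1)])

lemma smooth_sharp:
  assumes lin: "\<And>x. x \<in> S \<Longrightarrow> linear (\<alpha> x)" and \<alpha>: "\<And>w. smooth_on S (\<lambda>x. \<alpha> x w)"
  shows "smooth_on S (\<lambda>x. sharp h x (\<alpha> x))"
proof (rule smooth_on_cong[OF open_S sharp_eq[OF _ lin, symmetric]])
  have e2: "smooth_on S (\<lambda>x. basis_snd_orth (h x))"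
    unfolding basis_snd_orth_def
    by (intro smooth_on_diff smooth_on_scaleR smooth_on_divide smooth_on_const smooth_metric open_S)
      (metis hermitian_inner hermitian_inner.q_pos basis_fst_nonzero less_irrefl)+
  have J: "smooth_on S (\<lambda>x. J (s x))" if "smooth_on S s" for s
    by (rule smooth_on_field[OF open_S J_linear smooth_on_const that])
  have pos: "h x v v \<noteq> 0" if "x \<in> S" "v \<noteq> 0" for x v
    using hermitian_inner.q_pos[OF hermitian_inner[OF that(1)] that(2)] by simp
  show "smooth_on S (\<lambda>x. (\<alpha> x basis_fst / h x basis_fst basis_fst) *\<^sub>R basis_fst +
      (\<alpha> x (J basis_fst) / h x basis_fst basis_fst) *\<^sub>R J basis_fst +
      (\<alpha> x (basis_snd_orth (h x)) / h x (basis_snd_orth (h x)) (basis_snd_orth (h x))) *\<^sub>R basis_snd_orth (h x) +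
      (\<alpha> x (J (basis_snd_orth (h x))) / h x (basis_snd_orth (h x)) (basis_snd_orth (h x))) *\<^sub>R
        J (basis_snd_orth (h x)))"
    by (intro smooth_on_add smooth_on_scaleR smooth_on_divide smooth_on_const smooth_metric_field e2 J
        smooth_on_field[OF open_S lin \<alpha>] open_S pos basis_fst_nonzero basis_snd_orth_nonzero)
qed

text \<open>The Koszul 1-form has smooth components, so \<open>smooth_sharp\<close> yields smooth
  Christoffel symbols and the curvature theory becomes available.\<close>

sublocale smooth_metric_chart
proof
  fix u v
  show "smooth_on S (\<lambda>x. christoffel h x u v)"
    unfolding christoffel_def
  proof (rule smooth_sharp)
    show "linear (\<lambda>w. (dir_deriv (\<lambda>y. h y v w) x u + dir_deriv (\<lambda>y. h y u w) x v
      - dir_deriv (\<lambda>y. h y u v) x w) / 2)" if "x \<in> S" for x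
      by (rule linearI) (simp_all add: dir_deriv_metric_simps[OF that] field_simps)
    show "smooth_on S (\<lambda>x. (dir_deriv (\<lambda>y. h y v w) x u + dir_deriv (\<lambda>y. h y u w) x v
      - dir_deriv (\<lambda>y. h y u v) x w) / 2)" for w
      by (intro smooth_on_divide smooth_on_add smooth_on_diff smooth_on_dir_deriv smooth_metric
          smooth_on_const open_S) simp
  qed
qed

section \<open>The Hermitian form, its exterior derivative and \<nabla>J\<close>

abbreviation "d\<omega> \<equiv> ext_deriv_2form (\<lambda>y u v. h y u (J v))"

lemma dir_deriv_metric_J:
  assumes x: "x \<in> S"
  shows "dir_deriv (\<lambda>y. h y (J u) v) x w = - dir_deriv (\<lambda>y. h y u (J v)) x w"
proof -
  have "dir_deriv (\<lambda>y. h y (J u) v) x w = dir_deriv (\<lambda>y. h y u (J (- v))) x w"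
    using hermitian_inner.q_J_left[OF hermitian_inner]
    by (intro dir_deriv_cong_open[OF open_S x] differentiable_metric x)
      (simp add: J_simps metric_simps)
  then show ?thesis
    using linear_neg[OF linear_dir_deriv_metric(2)[OF x]] by (simp add: J_simps)
qed

lemma d\<omega>_linear:
  assumes x: "x \<in> S"
  shows "linear (\<lambda>u. d\<omega> x u v w)" "linear (\<lambda>v. d\<omega> x u v w)" "linear (d\<omega> x u v)"
  by (auto intro!: linearI simp: ext_deriv_2form_def dir_deriv_metric_simps[OF x] J_simps algebra_simps)

text \<open>\<open>J\<close> is skew for the metric and constant in the chart, so the derivatives of
  \<omega> inherit its skew symmetry.\<close>

lemma d\<omega>_alternating:
  assumes x: "x \<in> S"
  shows "d\<omega> x u v w = - d\<omega> x v u w" "d\<omega> x u v w = - d\<omega> x u w v"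
proof -
  have "dir_deriv (\<lambda>y. h y u (J v)) x w = - dir_deriv (\<lambda>y. h y v (J u)) x w" for u v w
    using dir_deriv_metric_J[OF x, of u v w] dir_deriv_metric_commute[OF x, of "J u" v w] by simp
  from this[of u v w] this[of v w u] show "d\<omega> x u v w = - d\<omega> x v u w" "d\<omega> x u v w = - d\<omega> x u w v"
    by (simp_all add: ext_deriv_2form_def)
qed

text \<open>The left-hand side is twice \<open>h ((\<nabla>\<^sub>u J) v) w\<close>, as \<open>J\<close> has constant components.\<close>

lemma cov_J_eq_d\<omega>:
  assumes x: "x \<in> S"
  shows "2 * h x (\<Gamma> x u (J v) - J (\<Gamma> x u v)) w = d\<omega> x u (J v) (J w) - d\<omega> x u v w"
proof -
  have "2 * h x (\<Gamma> x u (J v) - J (\<Gamma> x u v)) w = 2 * h x (\<Gamma> x u (J v)) w + 2 * h x (\<Gamma> x u v) (J w)"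
    using hermitian_inner.q_J_left[OF hermitian_inner[OF x]] by (simp add: metric_simps[OF x])
  \<comment> \<open>Integrability enters here: as \<open>J\<close> is constant in a holomorphic
    chart, the Koszul formula leaves only metric derivatives, which regroup into values of
    d\<omega>.\<close>
  then show ?thesis
    unfolding koszul[OF x] ext_deriv_2form_def J_J dir_deriv_metric_J[OF x]
    using linear_neg[OF linear_dir_deriv_metric(2)[OF x]] dir_deriv_metric_J[OF x, of v w u]
    by (simp add: J_simps)
qed

lemma scalar_curvature_eq:
  assumes x: "x \<in> S" and E: "frame (h x) E"
  shows "scalar_curvature h x = (\<Sum>e\<in>E. ricci h x e e)"
proof -
  have sharp: "h x (sharp h x (ricci h x u)) w = ricci h x u w" for u w
    by (rule sharp_works[of h x, OF metric[OF x] ricci_linear(1)[OF x]])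
  have lin: "linear (\<lambda>u. sharp h x (ricci h x u))"
    by (rule linearI; rule inner_product_form_eqI[OF metric[OF x]])
      (simp_all add: sharp metric_simps[OF x] ricci_simps[OF x])
  show ?thesis
    unfolding scalar_curvature_def endo_trace_frame[OF metric[OF x] E lin] sharp ..
qed

end

section \<open>Hermitian solitons with \<open>J\<close>-invariant Ricci tensor\<close>

locale hermitian_soliton_chart = hermitian_chart + soliton_chart S h +
  assumes ricci_J: "x \<in> S \<Longrightarrow> ricci h x (J u) (J v) = ricci h x u v"
begin

lemma ricci_J_left: "x \<in> S \<Longrightarrow> ricci h x (J u) v = - ricci h x u (J v)"
  using ricci_J[of x u "J v"] by (simp add: J_J ricci_simps)

lemma cov_ricci_neg:
  assumes x: "x \<in> S"
  shows "T x u (- v) w = - T x u v w"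
proof -
  have "linear (\<lambda>v. dir_deriv (\<lambda>y. ricci h y v w) x u)"
    by (rule linear_dir_deriv_field[OF open_S x ricci_linear(2) differentiable_ricci[OF x]])
  from linear_neg[OF this, of v] show ?thesis
    by (simp add: cov_deriv2_def christoffel_simps[OF x] ricci_simps[OF x])
qed

text \<open>Differentiate \<open>Ric(J v, w) + Ric(v, J w) = 0\<close>: the product rule leaves only
  the terms in which the derivative falls on \<open>J\<close>.\<close>

lemma cov_ricci_J:
  assumes x: "x \<in> S"
  shows "T x u (J v) w + T x u v (J w) =
    - (ricci h x (\<Gamma> x u (J v) - J (\<Gamma> x u v)) w + ricci h x v (\<Gamma> x u (J w) - J (\<Gamma> x u w)))"
proof -
  have "dir_deriv (\<lambda>y. ricci h y (J v) w + ricci h y v (J w)) x u = dir_deriv (\<lambda>_. 0) x u"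
    by (rule sym, rule dir_deriv_cong_open[OF open_S x]) (simp_all add: ricci_J_left)
  then have "dir_deriv (\<lambda>y. ricci h y (J v) w) x u + dir_deriv (\<lambda>y. ricci h y v (J w)) x u = 0"
    by (simp add: dir_deriv_add differentiable_ricci[OF x])
  then show ?thesis
    by (simp add: cov_deriv2_def ricci_simps[OF x] ricci_J_left[OF x])
qed

lemma tracefree_ricci_gradient_wedge:
  assumes x: "x \<in> S"
  shows "wedge_1_3 (tracefree_ricci h x (G x)) (d\<omega> x) u1 u2 u3 u4 = 0"
proof -
  interpret hermitian_inner "h x" by (rule hermitian_inner[OF x])
  obtain e1 e2 where "h x e1 e1 = 1" "h x e2 e2 = 1" "h x e1 e2 = 0" "h x e1 (J e2) = 0"
    by (rule unitary_frame)
  then interpret unitary_basis "h x" e1 e2 by unfold_locales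
  let ?E = "{e1, J e1, e2, J e2}" and ?N = "\<lambda>u v. \<Gamma> x u (J v) - J (\<Gamma> x u v)"
  \<comment> \<open>The terms for \<open>e\<close> and \<open>J e\<close> cancel, since
    \<open>J (J e) = - e\<close> and \<open>T x u v (G x)\<close> is symmetric in \<open>u\<close>
    and \<open>v\<close>.\<close>
  have "(\<Sum>e\<in>?E. T x e (J e) (G x)) = 0"
    unfolding sum_unitary_basis J_J cov_ricci_neg[OF x]
    using cov_ricci_gradient_commute[OF x, of e1 "J e1"] cov_ricci_gradient_commute[OF x, of e2 "J e2"] by simp
  moreover have "(\<Sum>e\<in>?E. T x e e (J (G x))) = 0"
  proof -
    have "(\<Sum>e\<in>?E. T x e e (J (G x))) = (\<Sum>e\<in>?E. T x e (J (G x)) e)"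
      by (rule sum.cong) (simp_all only: cov_ricci_commute[OF x, of _ "J (G x)"])
    also have "\<dots> = ricci h x (J (G x)) (G x)" by (rule divergence_ricci[OF x frame])
    also have "\<dots> = 0"
      using ricci_J_left[OF x, of "G x" "G x"] ricci_commute[OF x, of "J (G x)" "G x"] by simp
    finally show ?thesis .
  qed
  ultimately have "(\<Sum>e\<in>?E. T x e (J e) (G x) + T x e e (J (G x))) = 0"
    by (simp only: sum.distrib)
  then have sum: "(\<Sum>e\<in>?E. ricci h x (?N e e) (G x) + ricci h x e (?N e (G x))) = 0"
    unfolding cov_ricci_J[OF x] by (simp only: sum_negf neg_equal_0_iff_equal)
  have "tracefree_ricci h x (G x) =
      (\<lambda>w. ricci h x (G x) w - (\<Sum>e\<in>?E. ricci h x e e) / 4 * h x (G x) w)"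
    unfolding tracefree_ricci_def scalar_curvature_eq[OF x frame] ..
  then show ?thesis
    using wedge_tracefree_eq_0[of "ricci h x" "d\<omega> x" ?N, OF ricci_linear[OF x] ricci_commute[OF x] ricci_J[OF x]
        d\<omega>_linear[OF x] d\<omega>_alternating[OF x] cov_J_eq_d\<omega>[OF x] sum]
    by (simp only:)
qed

end

section \<open>From coordinate charts to the complex surface\<close>

theorem theorem1p1:
  fixes M :: "'a topology" and A :: "'a chart set"
    and g :: "'a tensor2_field" and f :: "'a \<Rightarrow> real"
  assumes surface: "complex_surface M A"
    and soliton: "gradient_shrinking_soliton M A g f"
    and hermitian: "J_invariant A g"
    and ricci_invariant: "J_invariant A (\<lambda>c. ricci (g c))"
  shows "\<forall>c\<in>A. \<forall>x\<in>chart_img c. \<forall>u1 u2 u3 u4.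
    wedge_1_3 (tracefree_ricci (g c) x (gradient (g c) (f \<circ> chart_point c) x))
      (ext_deriv_2form (hermitian_form g c) x) u1 u2 u3 u4 = 0"
proof (intro ballI allI)
  fix c x u1 u2 u3 u4
  assume c: "c \<in> A" and x: "x \<in> chart_img c"
  interpret hermitian_chart "chart_img c" "g c"
  proof
    show "open (chart_img c)" using surface c by (simp add: complex_surface_def is_chart_def)
  qed (use soliton hermitian c in
      \<open>auto simp: gradient_shrinking_soliton_def riemannian_metric_def J_invariant_def\<close>)
  \<comment> \<open>Smoothness of the Christoffel symbols comes from the preceding interpretation;
    1/2 is the constant of the soliton equation.\<close>
  interpret hermitian_soliton_chart "chart_img c" "g c" "f \<circ> chart_point c" "1/2"
    by unfold_locales (use soliton ricci_invariant c in
      \<open>auto simp: gradient_shrinking_soliton_def smooth_function_def J_invariant_def\<close>)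
  have "hermitian_form g c = (\<lambda>y u v. g c y u (J v))"
    by (intro ext) (simp add: hermitian_form_def)
  then show "wedge_1_3 (tracefree_ricci (g c) x (gradient (g c) (f \<circ> chart_point c) x))
      (ext_deriv_2form (hermitian_form g c) x) u1 u2 u3 u4 = 0"
    using tracefree_ricci_gradient_wedge[OF x] by simp
qed

end
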